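(* Let $n\ge1$ and let $V$ be the complex vector space with basis $v_1,\ldots,v_n$. If $k=1,2,\ldots$ and $1\le i_1,\ldots,i_k\le n$, then in the action of $A_k(n)$ on $V^{\otimes k}$, $$L_{k-\frac12}(v_{i_1}\otimes\cdots\otimes v_{i_k})=n\,v_{i_1}\otimes\cdots\otimes v_{i_k}-\sum_{j=1}^n\big(s_{i_k,j}v_{i_1}\otimes\cdots\otimes s_{i_k,j}v_{i_{k-1}}\big)\otimes v_{i_k}$$ and $$L_k(v_{i_1}\otimes\cdots\otimes v_{i_k})=\sum_{j=1}^n\big(s_{i_k,j}v_{i_1}\otimes\cdots\otimes s_{i_k,j}v_{i_{k-1}}\big)\otimes v_j.$$
   Context: Partition algebras. For an integer $k\ge1$ let $A_k$ be the set of all set partitions of $\{1,\ldots,k,1',\ldots,k'\}$, and let $A_{k-\frac12}\subseteq A_k$ be the subset of those in which $k$ and $k'$ lie in the same block. A partition is drawn as a graph with top vertices $1,\ldots,k$ and bottom vertices $1',\ldots,k'$, whose connected components are the blocks. For $\rho_1,\rho_2\in A_k$, $\rho_1\circ\rho_2\in A_k$ is obtained by placing $\rho_1$ above $\rho_2$, identifying the bottom row of $\rho_1$ with the top row of $\rho_2$, and deleting components contained entirely in the middle row. Let $R=\mathbb{Z}[z]$, $z$ an indeterminate. $\mathcal{A}_k(z)$ is the free $R$-module on $A_k$ with product $\rho_1\rho_2=z^{\ell}\,\rho_1\circ\rho_2$, where $\ell$ is the number of components deleted from the middle row; $\mathcal{A}_{k-\frac12}(z)$ is the subalgebra generated by $A_{k-\frac12}$,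 and $\mathcal{A}_0(z)=R$. Adding the block $\{k+1,(k+1)'\}$ embeds $\mathcal{A}_k(z)$ in $\mathcal{A}_{k+\frac12}(z)\subseteq\mathcal{A}_{k+1}(z)$. For an integer $n\ge1$, $A_r(n)=\mathcal{A}_r(z)\otimes_{\mathbb{Z}[z]}\mathbb{C}$ with $z$ acting on $\mathbb{C}$ as $n$. Elements: $s_i$ ($i\ge1$) has blocks $\{i,(i+1)'\},\{i+1,i'\}$ and $\{m,m'\}$ for $m\ne i,i+1$; $p_j$ ($j\ge1$) has blocks $\{j\},\{j'\}$ and $\{m,m'\}$ for $m\ne j$; $p_{i+\frac12}$ ($i\ge1$) has blocks $\{i,i+1,i',(i+1)'\}$ and $\{m,m'\}$ for $m\neq i,i+1$. The algebra $\mathcal{A}_r(z)$ is generated by $s_1,\ldots,s_{r-1},p_1,\ldots,p_r,p_{1+\frac12},\ldots,p_{r-\frac12}$. Recursive definitions. $L_0=0$, $L_1=p_1$, $\sigma_1=1$, $\sigma_2=s_1$, and $L_{i+1}=-s_iL_ip_{i+\frac12}-p_{i+\frac12}L_is_i+p_{i+\frac12}L_ip_{i+1}p_{i+\frac12}+s_iL_is_i+\sigma_{i+1}$ for $i\ge1$, where for $i\ge2$ $\sigma_{i+1}=s_{i-1}s_i\sigma_is_is_{i-1}+s_ip_{i-\frac12}L_{i-1}s_ip_{i-\frac12}s_i+p_{i-\frac12}L_{i-1}s_ip_{i-\frac12}-s_ip_{i-\frac12}L_{i-1}s_{i-1}p_{i+\frac12}p_ip_{i-\frac12}-p_{i-\frac12}p_ip_{i+\frac12}s_{i-1}L_{i-1}p_{i-\frac12}s_i.$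 Also $L_{\frac12}=0$, $\sigma_{\frac12}=1$, $\sigma_{1+\frac12}=1$, and $L_{i+\frac12}=-L_ip_{i+\frac12}-p_{i+\frac12}L_i+p_{i+\frac12}L_ip_ip_{i+\frac12}+s_iL_{i-\frac12}s_i+\sigma_{i+\frac12}$ for $i\ge1$, where for $i\ge2$ $\sigma_{i+\frac12}=s_{i-1}s_i\sigma_{i-\frac12}s_is_{i-1}+p_{i-\frac12}L_{i-1}s_ip_{i-\frac12}s_i+s_ip_{i-\frac12}L_{i-1}s_ip_{i-\frac12}-p_{i-\frac12}L_{i-1}s_{i-1}p_{i+\frac12}p_ip_{i-\frac12}-s_ip_{i-\frac12}p_ip_{i+\frac12}s_{i-1}L_{i-1}p_{i-\frac12}s_i.$ Here $L_k\in\mathcal{A}_k(z)$ and $L_{k-\frac12}\in\mathcal{A}_{k-\frac12}(z)\subseteq\mathcal{A}_k(z)$, and they act through their images in $A_k(n)$. Action on tensor space. $A_r(n)$ acts on $V^{\otimes r}$ by: $s_k$ ($1\le k\le r-1$) interchanges the $k$th and $(k+1)$st tensor factors; $p_{k+\frac12}(v_{i_1}\otimes\cdots\otimes v_{i_r})$ equals $v_{i_1}\otimes\cdots\otimes v_{i_r}$ if $i_k=i_{k+1}$ and $0$ otherwise ($1\le k\le r-1$); $p_k(v_{i_1}\otimes\cdots\otimes v_{i_r})=\sum_{j=1}^n v_{i_1}\otimes\cdots\otimes v_{i_{k-1}}\otimes v_j\otimes v_{i_{k+1}}\otimes\cdots\otimes v_{i_r}$ ($1\le k\le r$). For $1\le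 a,b\le n$, $s_{a,b}\in\mathfrak{S}_n$ is the transposition interchanging $a$ and $b$ (the identity if $a=b$), acting on $V$ by permuting the basis: $s_{a,b}v_c=v_{s_{a,b}(c)}$. *)

theory Defs
  imports
    Complex_Main
    "HOL-Library.Poly_Mapping"
    "HOL-Library.Disjoint_Sets"
    "HOL-Library.FuncSet"
    "HOL-Library.Function_Algebras"
    "HOL-Combinatorics.Transposition"
    "HOL-Computational_Algebra.Polynomial"
begin

section \<open>Diagrams\<close>

text \<open>
  \<open>Top m\<close> and \<open>Bot m\<close> are the vertices written $m$ and $m'$; \<open>Mid m\<close> occurs only in the
  three-row graph that defines the composite of two diagrams.
\<close>

datatype vertex = Top nat | Mid nat | Bot nat

type_synonym diagram = "vertex set set"

definition diagrams :: "nat \<Rightarrow> diagram set" where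
  "diagrams k = {d. partition_on (Top ` {1..k} \<union> Bot ` {1..k}) d}"

fun to_upper :: "vertex \<Rightarrow> vertex" where
  "to_upper (Top m) = Top m"
| "to_upper (Mid m) = Mid m"
| "to_upper (Bot m) = Mid m"

fun to_lower :: "vertex \<Rightarrow> vertex" where
  "to_lower (Top m) = Mid m"
| "to_lower (Mid m) = Mid m"
| "to_lower (Bot m) = Bot m"

text \<open>The connected components of the graph in which any two members of a common block are joined.\<close>

definition graph_components :: "vertex set set \<Rightarrow> vertex set set" where
  "graph_components \<B> = \<Union>\<B> // (\<Union>B\<in>\<B>. B \<times> B)\<^sup>+"

definition stacked :: "diagram \<Rightarrow> diagram \<Rightarrow> vertex set set" where
  "stacked d e = graph_components ((`) to_upper ` d \<union> (`) to_lower ` e)"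

text \<open>\<open>d\<close> is placed above \<open>e\<close>.\<close>

definition diagram_comp :: "diagram \<Rightarrow> diagram \<Rightarrow> diagram" where
  "diagram_comp d e = (\<lambda>C. C - range Mid) ` {C \<in> stacked d e. \<not> C \<subseteq> range Mid}"

definition loops :: "diagram \<Rightarrow> diagram \<Rightarrow> nat" where
  "loops d e = card {C \<in> stacked d e. C \<subseteq> range Mid}"

definition extend_diagram :: "nat \<Rightarrow> nat \<Rightarrow> diagram \<Rightarrow> diagram" where
  "extend_diagram k r d = d \<union> {{Top m, Bot m} | m. m \<in> {k<..r}}"

definition id_diagram :: "nat \<Rightarrow> diagram" where
  "id_diagram r = {{Top m, Bot m} | m. m \<in> {1..r}}"

definition s_diagram :: "nat \<Rightarrow> nat \<Rightarrow> diagram" where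
  "s_diagram r i = {{Top i, Bot (i + 1)}, {Top (i + 1), Bot i}}
     \<union> {{Top m, Bot m} | m. m \<in> {1..r} - {i, i + 1}}"

definition p_diagram :: "nat \<Rightarrow> nat \<Rightarrow> diagram" where
  "p_diagram r j = {{Top j}, {Bot j}} \<union> {{Top m, Bot m} | m. m \<in> {1..r} - {j}}"

definition p_half_diagram :: "nat \<Rightarrow> nat \<Rightarrow> diagram" where
  "p_half_diagram r i = {{Top i, Top (i + 1), Bot i, Bot (i + 1)}}
     \<union> {{Top m, Bot m} | m. m \<in> {1..r} - {i, i + 1}}"


section \<open>Partition algebras\<close>

text \<open>
  Over any commutative ring and for any parameter \<open>\<delta>\<close>, the partition algebra is the free module on
  the diagrams in which deleted components contribute powers of \<open>\<delta>\<close>. The algebra $\mathcal{A}_k(z)$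
  is the case of the ring $\mathbb{Z}[z]$ with \<open>\<delta> = z\<close>. Its base change $A_k(n)$ along
  $z \mapsto n$ is the case of the ring $\mathbb{C}$ with \<open>\<delta> = n\<close>, and \<open>specialize n\<close> is the
  canonical map $\mathcal{A}_k(z) \to A_k(n)$.
\<close>

definition partition_algebra :: "nat \<Rightarrow> (diagram \<Rightarrow>\<^sub>0 'r::comm_ring_1) set" where
  "partition_algebra k = {x. Poly_Mapping.keys x \<subseteq> diagrams k}"

definition pa_mult ::
    "'r::comm_ring_1 \<Rightarrow> (diagram \<Rightarrow>\<^sub>0 'r) \<Rightarrow> (diagram \<Rightarrow>\<^sub>0 'r) \<Rightarrow> (diagram \<Rightarrow>\<^sub>0 'r)" where
  "pa_mult \<delta> x y = (\<Sum>d\<in>Poly_Mapping.keys x. \<Sum>e\<in>Poly_Mapping.keys y.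
     Poly_Mapping.single (diagram_comp d e)
       (\<delta> ^ loops d e * Poly_Mapping.lookup x d * Poly_Mapping.lookup y e))"

abbreviation pa_scale :: "'r::comm_ring_1 \<Rightarrow> (diagram \<Rightarrow>\<^sub>0 'r) \<Rightarrow> (diagram \<Rightarrow>\<^sub>0 'r)" where
  "pa_scale c x \<equiv> Poly_Mapping.map ((*) c) x"

definition pa_one :: "nat \<Rightarrow> (diagram \<Rightarrow>\<^sub>0 'r::comm_ring_1)" where
  "pa_one r = Poly_Mapping.single (id_diagram r) 1"

definition gen_s :: "nat \<Rightarrow> nat \<Rightarrow> (diagram \<Rightarrow>\<^sub>0 'r::comm_ring_1)" where
  "gen_s r i = Poly_Mapping.single (s_diagram r i) 1"

definition gen_p :: "nat \<Rightarrow> nat \<Rightarrow> (diagram \<Rightarrow>\<^sub>0 'r::comm_ring_1)" where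
  "gen_p r j = Poly_Mapping.single (p_diagram r j) 1"

text \<open>\<open>gen_p_half r i\<close> is $p_{i+1/2}$ in the algebra on \<open>r\<close> strands.\<close>

definition gen_p_half :: "nat \<Rightarrow> nat \<Rightarrow> (diagram \<Rightarrow>\<^sub>0 'r::comm_ring_1)" where
  "gen_p_half r i = Poly_Mapping.single (p_half_diagram r i) 1"

definition pa_embed :: "nat \<Rightarrow> nat \<Rightarrow> (diagram \<Rightarrow>\<^sub>0 'r::comm_ring_1) \<Rightarrow> (diagram \<Rightarrow>\<^sub>0 'r)" where
  "pa_embed k r x = (\<Sum>d\<in>Poly_Mapping.keys x.
     Poly_Mapping.single (extend_diagram k r d) (Poly_Mapping.lookup x d))"

definition specialize :: "nat \<Rightarrow> (diagram \<Rightarrow>\<^sub>0 int poly) \<Rightarrow> (diagram \<Rightarrow>\<^sub>0 complex)" where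
  "specialize n x = Poly_Mapping.map (\<lambda>q. poly (map_poly of_int q) (of_nat n)) x"


section \<open>The recursively defined elements\<close>

abbreviation pa_mult_z ::
    "(diagram \<Rightarrow>\<^sub>0 int poly) \<Rightarrow> (diagram \<Rightarrow>\<^sub>0 int poly) \<Rightarrow> (diagram \<Rightarrow>\<^sub>0 int poly)"
    (infixl "\<star>" 70) where
  "x \<star> y \<equiv> pa_mult [:0, 1:] x y"

text \<open>
  The recursive formulas, with all factors in $\mathcal{A}_{i+1}(z)$. The arguments stand for the
  images of elements obtained earlier: \<open>X\<close> for $L_i$, \<open>Y\<close> for $L_{i-1/2}$, \<open>W\<close> for $L_{i-1}$,
  and \<open>S\<close> for the $\sigma$ occurring on the right-hand side.
\<close>

definition L_step ::
    "nat \<Rightarrow> (diagram \<Rightarrow>\<^sub>0 int poly) \<Rightarrow> (diagram \<Rightarrow>\<^sub>0 int poly) \<Rightarrow> (diagram \<Rightarrow>\<^sub>0 int poly)" where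
  "L_step i X S = (let s = gen_s (i + 1); p = gen_p (i + 1); h = gen_p_half (i + 1) in
     - (s i \<star> X \<star> h i) - h i \<star> X \<star> s i + h i \<star> X \<star> p (i + 1) \<star> h i + s i \<star> X \<star> s i + S)"

definition sigma_step ::
    "nat \<Rightarrow> (diagram \<Rightarrow>\<^sub>0 int poly) \<Rightarrow> (diagram \<Rightarrow>\<^sub>0 int poly) \<Rightarrow> (diagram \<Rightarrow>\<^sub>0 int poly)" where
  "sigma_step i S W = (let s = gen_s (i + 1); p = gen_p (i + 1); h = gen_p_half (i + 1) in
     s (i - 1) \<star> s i \<star> S \<star> s i \<star> s (i - 1)
     + s i \<star> h (i - 1) \<star> W \<star> s i \<star> h (i - 1) \<star> s i
     + h (i - 1) \<star> W \<star> s i \<star> h (i - 1)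
     - s i \<star> h (i - 1) \<star> W \<star> s (i - 1) \<star> h i \<star> p i \<star> h (i - 1)
     - h (i - 1) \<star> p i \<star> h i \<star> s (i - 1) \<star> W \<star> h (i - 1) \<star> s i)"

definition L_half_step ::
    "nat \<Rightarrow> (diagram \<Rightarrow>\<^sub>0 int poly) \<Rightarrow> (diagram \<Rightarrow>\<^sub>0 int poly) \<Rightarrow> (diagram \<Rightarrow>\<^sub>0 int poly)
      \<Rightarrow> (diagram \<Rightarrow>\<^sub>0 int poly)" where
  "L_half_step i X Y S = (let s = gen_s (i + 1); p = gen_p (i + 1); h = gen_p_half (i + 1) in
     - (X \<star> h i) - h i \<star> X + h i \<star> X \<star> p i \<star> h i + s i \<star> Y \<star> s i + S)"

definition sigma_half_step ::
    "nat \<Rightarrow> (diagram \<Rightarrow>\<^sub>0 int poly) \<Rightarrow> (diagram \<Rightarrow>\<^sub>0 int poly) \<Rightarrow> (diagram \<Rightarrow>\<^sub>0 int poly)" where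
  "sigma_half_step i S W = (let s = gen_s (i + 1); p = gen_p (i + 1); h = gen_p_half (i + 1) in
     s (i - 1) \<star> s i \<star> S \<star> s i \<star> s (i - 1)
     + h (i - 1) \<star> W \<star> s i \<star> h (i - 1) \<star> s i
     + s i \<star> h (i - 1) \<star> W \<star> s i \<star> h (i - 1)
     - h (i - 1) \<star> W \<star> s (i - 1) \<star> h i \<star> p i \<star> h (i - 1)
     - s i \<star> h (i - 1) \<star> p i \<star> h i \<star> s (i - 1) \<star> W \<star> h (i - 1) \<star> s i)"

text \<open>
  \<open>L_int k\<close> and \<open>sigma_int k\<close> are elements of $\mathcal{A}_k(z)$; the defining equations for index $i+1$
  are those with $i$ equal to \<open>Suc j\<close> (for \<open>L_int\<close>) and \<open>Suc (Suc j)\<close> (for \<open>sigma_int\<close>). There is no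
  $\sigma_0$, so \<open>sigma_int 0\<close> is left unspecified.
\<close>

fun L_int :: "nat \<Rightarrow> (diagram \<Rightarrow>\<^sub>0 int poly)"
  and sigma_int :: "nat \<Rightarrow> (diagram \<Rightarrow>\<^sub>0 int poly)" where
  "L_int 0 = 0"
| "L_int (Suc 0) = gen_p 1 1"
| "L_int (Suc (Suc j)) =
     L_step (Suc j) (pa_embed (Suc j) (Suc (Suc j)) (L_int (Suc j))) (sigma_int (Suc (Suc j)))"
| "sigma_int (Suc 0) = pa_one 1"
| "sigma_int (Suc (Suc 0)) = gen_s 2 1"
| "sigma_int (Suc (Suc (Suc j))) =
     sigma_step (Suc (Suc j))
       (pa_embed (Suc (Suc j)) (Suc (Suc (Suc j))) (sigma_int (Suc (Suc j))))
       (pa_embed (Suc j) (Suc (Suc (Suc j))) (L_int (Suc j)))"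

text \<open>
  The half-integer families are indexed by the number of strands: \<open>L_half k\<close> is $L_{k-1/2}$ and
  \<open>sigma_half k\<close> is $\sigma_{k-1/2}$, both regarded as elements of $\mathcal{A}_k(z)$, for
  $k \ge 1$.
\<close>

fun sigma_half :: "nat \<Rightarrow> (diagram \<Rightarrow>\<^sub>0 int poly)" where
  "sigma_half (Suc 0) = pa_one 1"
| "sigma_half (Suc (Suc 0)) = pa_one 2"
| "sigma_half (Suc (Suc (Suc j))) =
     sigma_half_step (Suc (Suc j))
       (pa_embed (Suc (Suc j)) (Suc (Suc (Suc j))) (sigma_half (Suc (Suc j))))
       (pa_embed (Suc j) (Suc (Suc (Suc j))) (L_int (Suc j)))"

fun L_half :: "nat \<Rightarrow> (diagram \<Rightarrow>\<^sub>0 int poly)" where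
  "L_half (Suc 0) = 0"
| "L_half (Suc (Suc j)) =
     L_half_step (Suc j)
       (pa_embed (Suc j) (Suc (Suc j)) (L_int (Suc j)))
       (pa_embed (Suc j) (Suc (Suc j)) (L_half (Suc j)))
       (sigma_half (Suc (Suc j)))"


section \<open>Tensor space\<close>

text \<open>
  $V$ is the space of functions \<open>nat \<Rightarrow> complex\<close> vanishing outside $\{1,\dots,n\}$, with the unit
  vectors as basis, and $V^{\otimes r}$ is the space of functions on the multi-indices
  $(m_1,\dots,m_r) \in \{1,\dots,n\}^r$, that is, of functions on \<open>nat \<Rightarrow> nat\<close> vanishing outside
  \<open>multi_indices n r\<close>. Only the values of \<open>w\<close> on $\{1,\dots,r\}$ matter in \<open>tensor r w\<close>, which is
  $w_1 \otimes \cdots \otimes w_r$.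
\<close>

type_synonym tensor = "(nat \<Rightarrow> nat) \<Rightarrow> complex"

definition multi_indices :: "nat \<Rightarrow> nat \<Rightarrow> (nat \<Rightarrow> nat) set" where
  "multi_indices n r = {1..r} \<rightarrow>\<^sub>E {1..n}"

definition tensor_space :: "nat \<Rightarrow> nat \<Rightarrow> tensor set" where
  "tensor_space n r = {u. \<forall>m. m \<notin> multi_indices n r \<longrightarrow> u m = 0}"

definition unit_vec :: "nat \<Rightarrow> (nat \<Rightarrow> complex)" where
  "unit_vec c = (\<lambda>a. if a = c then 1 else 0)"

definition tensor :: "nat \<Rightarrow> (nat \<Rightarrow> (nat \<Rightarrow> complex)) \<Rightarrow> tensor" where
  "tensor r w = (\<lambda>m. if m \<in> extensional {1..r} then \<Prod>t=1..r. w t (m t) else 0)"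

definition tensor_scale :: "complex \<Rightarrow> tensor \<Rightarrow> tensor" (infixr "\<cdot>" 75) where
  "c \<cdot> u = (\<lambda>m. c * u m)"

text \<open>The linear action of a permutation on $V$, determined by $v_c \mapsto v_{\pi(c)}$.\<close>

definition perm_vec :: "(nat \<Rightarrow> nat) \<Rightarrow> (nat \<Rightarrow> complex) \<Rightarrow> (nat \<Rightarrow> complex)" where
  "perm_vec \<pi> w = (\<lambda>a. w (inv \<pi> a))"

lemma perm_vec_unit_vec: "bij \<pi> \<Longrightarrow> perm_vec \<pi> (unit_vec c) = unit_vec (\<pi> c)"
  unfolding perm_vec_def unit_vec_def by (metis bij_inv_eq_iff)

text \<open>
  The action of $A_r(n)$ on $V^{\otimes r}$, specified by the operators of the generators. Such an
  action is unique because the generators generate the algebra; it exists by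
  \<open>tensor_action_exists\<close> below.
\<close>

locale tensor_action =
  fixes n r :: nat and act :: "(diagram \<Rightarrow>\<^sub>0 complex) \<Rightarrow> tensor \<Rightarrow> tensor"
  assumes act_closed:
      "\<lbrakk>x \<in> partition_algebra r; u \<in> tensor_space n r\<rbrakk> \<Longrightarrow> act x u \<in> tensor_space n r"
    and act_add_right:
      "\<lbrakk>x \<in> partition_algebra r; u \<in> tensor_space n r; w \<in> tensor_space n r\<rbrakk>
        \<Longrightarrow> act x (u + w) = act x u + act x w"
    and act_scale_right:
      "\<lbrakk>x \<in> partition_algebra r; u \<in> tensor_space n r\<rbrakk> \<Longrightarrow> act x (c \<cdot> u) = c \<cdot> act x u"
    and act_add_left:
      "\<lbrakk>x \<in> partition_algebra r; y \<in> partition_algebra r; u \<in> tensor_space n r\<rbrakk>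
        \<Longrightarrow> act (x + y) u = act x u + act y u"
    and act_scale_left:
      "\<lbrakk>x \<in> partition_algebra r; u \<in> tensor_space n r\<rbrakk> \<Longrightarrow> act (pa_scale c x) u = c \<cdot> act x u"
    and act_one:
      "u \<in> tensor_space n r \<Longrightarrow> act (pa_one r) u = u"
    and act_mult:
      "\<lbrakk>x \<in> partition_algebra r; y \<in> partition_algebra r; u \<in> tensor_space n r\<rbrakk>
        \<Longrightarrow> act (pa_mult (of_nat n) x y) u = act x (act y u)"
    and act_s:
      "\<lbrakk>1 \<le> k; k + 1 \<le> r; i \<in> {1..r} \<rightarrow> {1..n}\<rbrakk>
        \<Longrightarrow> act (gen_s r k) (tensor r (\<lambda>t. unit_vec (i t)))
            = tensor r (\<lambda>t. unit_vec (i (transpose k (k + 1) t)))"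
    and act_p_half:
      "\<lbrakk>1 \<le> k; k + 1 \<le> r; i \<in> {1..r} \<rightarrow> {1..n}\<rbrakk>
        \<Longrightarrow> act (gen_p_half r k) (tensor r (\<lambda>t. unit_vec (i t)))
            = (if i k = i (k + 1) then tensor r (\<lambda>t. unit_vec (i t)) else 0)"
    and act_p:
      "\<lbrakk>1 \<le> k; k \<le> r; i \<in> {1..r} \<rightarrow> {1..n}\<rbrakk>
        \<Longrightarrow> act (gen_p r k) (tensor r (\<lambda>t. unit_vec (i t)))
            = (\<Sum>j=1..n. tensor r (\<lambda>t. if t = k then unit_vec j else unit_vec (i t)))"


section \<open>Existence of the action\<close>

text \<open>
  The matrix entry of a diagram at the multi-indices $a$ (top row) and $b$ (bottom row) is $1$ if
  labelling the vertices by $a$ and $b$ is constant on every block, and $0$ otherwise.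
\<close>

fun lab :: "(nat \<Rightarrow> nat) \<Rightarrow> (nat \<Rightarrow> nat) \<Rightarrow> (nat \<Rightarrow> nat) \<Rightarrow> vertex \<Rightarrow> nat" where
  "lab a m b (Top t) = a t"
| "lab a m b (Mid t) = m t"
| "lab a m b (Bot t) = b t"

definition compatible :: "diagram \<Rightarrow> (nat \<Rightarrow> nat) \<Rightarrow> (nat \<Rightarrow> nat) \<Rightarrow> bool" where
  "compatible d a b \<longleftrightarrow> (\<forall>B\<in>d. \<forall>x\<in>B. \<forall>y\<in>B. lab a (\<lambda>_. 0) b x = lab a (\<lambda>_. 0) b y)"

definition diagram_op :: "nat \<Rightarrow> nat \<Rightarrow> diagram \<Rightarrow> tensor \<Rightarrow> tensor" where
  "diagram_op n r d u = (\<lambda>a. if a \<in> multi_indices n r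
     then \<Sum>b\<in>multi_indices n r. if compatible d a b then u b else 0 else 0)"

definition diagram_act :: "nat \<Rightarrow> nat \<Rightarrow> (diagram \<Rightarrow>\<^sub>0 complex) \<Rightarrow> tensor \<Rightarrow> tensor" where
  "diagram_act n r x u = (\<lambda>a. \<Sum>d\<in>diagrams r. Poly_Mapping.lookup x d * diagram_op n r d u a)"

lemma finite_diagrams: "finite (diagrams r)"
  unfolding diagrams_def by (rule finitely_many_partition_on) simp

lemma finite_multi_indices: "finite (multi_indices n r)"
  unfolding multi_indices_def by (simp add: finite_PiE)

lemma equiv_components: "equiv (\<Union>\<B>) ((\<Union>B\<in>\<B>. B \<times> B)\<^sup>+)"
proof (rule equivI)
  show "refl_on (\<Union>\<B>) ((\<Union>B\<in>\<B>. B \<times> B)\<^sup>+)"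
    by (auto simp: refl_on_def)
  show "(\<Union>B\<in>\<B>. B \<times> B)\<^sup>+ \<subseteq> \<Union>\<B> \<times> \<Union>\<B>"
    by (rule trancl_subset_Sigma) auto
  show "sym ((\<Union>B\<in>\<B>. B \<times> B)\<^sup>+)"
    by (rule sym_trancl) (auto simp: sym_def)
  show "trans ((\<Union>B\<in>\<B>. B \<times> B)\<^sup>+)" by simp
qed

lemma partition_on_components: "partition_on (\<Union>\<B>) (graph_components \<B>)"
  unfolding graph_components_def by (rule partition_on_quotient[OF equiv_components])

lemma constant_on_components:
  "(\<forall>C\<in>graph_components \<B>. \<forall>x\<in>C. \<forall>y\<in>C. f x = f y) \<longleftrightarrow> (\<forall>B\<in>\<B>. \<forall>x\<in>B. \<forall>y\<in>B. f x = f y)"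
    (is "?L \<longleftrightarrow> ?R")
proof
  assume L: ?L
  show ?R
  proof (intro ballI)
    fix B x y assume *: "B \<in> \<B>" "x \<in> B" "y \<in> B"
    let ?C = "((\<Union>B\<in>\<B>. B \<times> B)\<^sup>+) `` {x}"
    have "?C \<in> graph_components \<B>" "x \<in> ?C" "y \<in> ?C"
      using * unfolding graph_components_def by (auto intro!: quotientI)
    then show "f x = f y" using L by blast
  qed
next
  assume R: ?R
  have *: "(x, y) \<in> (\<Union>B\<in>\<B>. B \<times> B)\<^sup>+ \<Longrightarrow> f x = f y" for x y
  proof (induction rule: trancl_induct)
    case (base y) then show ?case using R by blast
  next
    case (step y z)
    then have "f y = f z" using R by blast
    then show ?case using step by simp
  qed
  show ?L
    unfolding graph_components_def by (auto elim!: quotientE dest!: *)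
qed

lemma stacked_partition:
  assumes "d \<in> diagrams r" "e \<in> diagrams r"
  shows "partition_on (Top ` {1..r} \<union> Mid ` {1..r} \<union> Bot ` {1..r}) (stacked d e)"
proof -
  have "\<Union>((`) to_upper ` d \<union> (`) to_lower ` e) = to_upper ` \<Union>d \<union> to_lower ` \<Union>e" by auto
  also have "\<dots> = Top ` {1..r} \<union> Mid ` {1..r} \<union> Bot ` {1..r}"
    using assms by (simp add: diagrams_def partition_on_def image_Un image_image) auto
  finally show ?thesis
    using partition_on_components[of "(`) to_upper ` d \<union> (`) to_lower ` e"] unfolding stacked_def by simp
qed

lemma compat_stacked:
  assumes "d \<in> diagrams r" "e \<in> diagrams r"
  shows "compatible d a m \<and> compatible e m c
    \<longleftrightarrow> (\<forall>C\<in>stacked d e. \<forall>x\<in>C. \<forall>y\<in>C. lab a m c x = lab a m c y)"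
proof -
  have d: "lab a m c (to_upper x) = lab a (\<lambda>_. 0) m x" if "B \<in> d" "x \<in> B" for B x
  proof -
    have "x \<in> Top ` {1..r} \<union> Bot ` {1..r}"
      using that assms(1) by (auto simp: diagrams_def partition_on_def)
    then show ?thesis by auto
  qed
  have e: "lab a m c (to_lower x) = lab m (\<lambda>_. 0) c x" if "B \<in> e" "x \<in> B" for B x
  proof -
    have "x \<in> Top ` {1..r} \<union> Bot ` {1..r}"
      using that assms(2) by (auto simp: diagrams_def partition_on_def)
    then show ?thesis by auto
  qed
  have 1: "compatible d a m \<longleftrightarrow>
      (\<forall>B\<in>(`) to_upper ` d. \<forall>x\<in>B. \<forall>y\<in>B. lab a m c x = lab a m c y)"
    unfolding compatible_def ball_simps by (intro ball_cong refl) (simp only: d)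
  have 2: "compatible e m c \<longleftrightarrow>
      (\<forall>B\<in>(`) to_lower ` e. \<forall>x\<in>B. \<forall>y\<in>B. lab a m c x = lab a m c y)"
    unfolding compatible_def ball_simps by (intro ball_cong refl) (simp only: e)
  show ?thesis
    unfolding stacked_def constant_on_components ball_Un 1 2 ..
qed

lemma diagram_comp_in_diagrams:
  assumes "d \<in> diagrams r" "e \<in> diagrams r"
  shows "diagram_comp d e \<in> diagrams r"
proof -
  let ?W = "Top ` {1..r} \<union> Mid ` {1..r} \<union> Bot ` {1..r}"
  have "partition_on (- range Mid \<inter> ?W) ((\<inter>) (- range Mid) ` stacked d e - {{}})"
    by (rule partition_on_restrict[OF stacked_partition[OF assms]])
  moreover have "- range Mid \<inter> ?W = Top ` {1..r} \<union> Bot ` {1..r}" by auto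
  moreover have "(\<inter>) (- range Mid) ` stacked d e - {{}} = diagram_comp d e"
    unfolding diagram_comp_def by auto
  ultimately show ?thesis unfolding diagrams_def by simp
qed

lemma card_middle_labellings:
  assumes d: "d \<in> diagrams r" and e: "e \<in> diagrams r"
    and a: "a \<in> multi_indices n r" and c: "c \<in> multi_indices n r"
  shows "card {m \<in> multi_indices n r. compatible d a m \<and> compatible e m c}
    = (if compatible (diagram_comp d e) a c then n ^ loops d e else 0)"
proof -
  define W where "W = Top ` {1..r} \<union> Mid ` {1..r} \<union> Bot ` {1..r}"
  define \<C> where "\<C> = stacked d e"
  define Inn where "Inn = {C \<in> \<C>. C \<subseteq> range Mid}"
  define S where "S = {m \<in> multi_indices n r. \<forall>C\<in>\<C>. \<forall>x\<in>C. \<forall>y\<in>C. lab a m c x = lab a m c y}"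
  have S: "{m \<in> multi_indices n r. compatible d a m \<and> compatible e m c} = S"
    unfolding S_def \<C>_def compat_stacked[OF d e] ..
  have part: "partition_on W \<C>"
    unfolding W_def \<C>_def by (rule stacked_partition[OF d e])
  have uniq: "C = C'" if "C \<in> \<C>" "C' \<in> \<C>" "v \<in> C" "v \<in> C'" for C C' v
    using part that unfolding partition_on_def disjoint_def by blast
  have "\<exists>cls. \<forall>v\<in>W. cls v \<in> \<C> \<and> v \<in> cls v"
    using part unfolding partition_on_def by (intro bchoice) blast
  then obtain cls where cls: "\<And>v. v \<in> W \<Longrightarrow> cls v \<in> \<C>" "\<And>v. v \<in> W \<Longrightarrow> v \<in> cls v" by blast
  have CW: "v \<in> W" if "C \<in> \<C>" "v \<in> C" for C v
    using part that unfolding partition_on_def by blast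
  have cls_eq: "cls v = C" if "C \<in> \<C>" "v \<in> C" for C v
    using uniq[OF cls(1) that(1) cls(2) that(2)] CW[OF that] by blast
  have nonempty: "C \<noteq> {}" if "C \<in> \<C>" for C
    using part that unfolding partition_on_def by metis
  have finC: "finite \<C>"
    using part by (rule finite_elements[rotated]) (simp add: W_def)
  have comp: "compatible (diagram_comp d e) a c \<longleftrightarrow>
      (\<forall>C\<in>\<C>. \<forall>x\<in>C - range Mid. \<forall>y\<in>C - range Mid. lab a m c x = lab a m c y)" for m
  proof -
    have l: "lab a (\<lambda>_. 0) c x = lab a m c x" if "x \<notin> range Mid" for x
      using that by (cases x) auto
    have "compatible (diagram_comp d e) a c \<longleftrightarrow>
        (\<forall>C\<in>{C \<in> \<C>. \<not> C \<subseteq> range Mid}. \<forall>x\<in>C - range Mid. \<forall>y\<in>C - range Mid.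
           lab a (\<lambda>_. 0) c x = lab a (\<lambda>_. 0) c y)"
      unfolding compatible_def diagram_comp_def \<C>_def ball_simps ..
    also have "\<dots> \<longleftrightarrow> (\<forall>C\<in>{C \<in> \<C>. \<not> C \<subseteq> range Mid}. \<forall>x\<in>C - range Mid. \<forall>y\<in>C - range Mid.
           lab a m c x = lab a m c y)"
      by (intro ball_cong refl) (simp only: l Diff_iff simp_thms)
    also have "\<dots> \<longleftrightarrow> (\<forall>C\<in>\<C>. \<forall>x\<in>C - range Mid. \<forall>y\<in>C - range Mid. lab a m c x = lab a m c y)"
      by blast
    finally show ?thesis .
  qed
  have am: "a t \<in> {1..n}" "c t \<in> {1..n}" if "t \<in> {1..r}" for t
    using a c that unfolding multi_indices_def by auto
  show ?thesis
  proof (cases "compatible (diagram_comp d e) a c")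
    case False
    then have "m \<notin> S" for m unfolding S_def comp[of m] by (simp, meson DiffD1)
    then have "S = {}" by blast
    then show ?thesis unfolding S using False by simp
  next
    case True
    define val where "val g C = (if C \<in> Inn then g C
       else lab a (\<lambda>_. 0) c (SOME v. v \<in> C \<and> v \<notin> range Mid))" for g C
    define F where "F g = (\<lambda>t. if t \<in> {1..r} then val g (cls (Mid t)) else undefined)" for g
    have out: "(SOME v. v \<in> C \<and> v \<notin> range Mid) \<in> C - range Mid" if "C \<in> \<C>" "C \<notin> Inn" for C
    proof -
      have "\<exists>v. v \<in> C \<and> v \<notin> range Mid" using that unfolding Inn_def by blast
      from someI_ex[OF this] show ?thesis by blast
    qed
    have outer: "lab a (F g) c v = val g C" if "C \<in> \<C>" "v \<in> C" "v \<notin> range Mid" for g C v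
    proof -
      have "C \<notin> Inn" using that(2,3) unfolding Inn_def by blast
      let ?v = "SOME v. v \<in> C \<and> v \<notin> range Mid"
      have v: "?v \<in> C - range Mid" by (rule out[OF that(1) \<open>C \<notin> Inn\<close>])
      have "lab a (F g) c v = lab a (F g) c ?v"
        using True[unfolded comp[of "F g"]] that v by (meson DiffI)
      also have "\<dots> = lab a (\<lambda>_. 0) c ?v" using v by (cases ?v) auto
      also have "\<dots> = val g C" using \<open>C \<notin> Inn\<close> by (simp add: val_def)
      finally show ?thesis .
    qed
    have const: "lab a (F g) c v = val g C" if C: "C \<in> \<C>" "v \<in> C" for g C v
    proof (cases v)
      case (Mid t)
      then have "t \<in> {1..r}" using CW[OF C] by (auto simp: W_def)
      then show ?thesis using Mid cls_eq[OF C] by (simp add: F_def)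
    next
      case (Top t)
      then have "v \<notin> range Mid" by auto
      then show ?thesis by (rule outer[OF C])
    next
      case (Bot t)
      then have "v \<notin> range Mid" by auto
      then show ?thesis by (rule outer[OF C])
    qed
    have val_in: "val g C \<in> {1..n}" if "g \<in> Inn \<rightarrow>\<^sub>E {1..n}" "C \<in> \<C>" for g C
    proof (cases "C \<in> Inn")
      case True
      then show ?thesis using that by (auto simp: val_def)
    next
      case False
      let ?v = "SOME v. v \<in> C \<and> v \<notin> range Mid"
      have "?v \<in> W - range Mid" using out[OF that(2) False] CW[OF that(2)] by blast
      then have "lab a (\<lambda>_. 0) c ?v \<in> {1..n}"
        using am by (auto simp: W_def simp del: atLeastAtMost_iff)
      then show ?thesis using False by (simp add: val_def)
    qed
    have inj: "inj_on F (Inn \<rightarrow>\<^sub>E {1..n})"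
    proof (rule inj_onI)
      fix g g' assume g: "g \<in> Inn \<rightarrow>\<^sub>E {1..n}" "g' \<in> Inn \<rightarrow>\<^sub>E {1..n}" and eq: "F g = F g'"
      show "g = g'"
      proof (rule PiE_ext[OF g])
        fix C assume C: "C \<in> Inn"
        then have CC: "C \<in> \<C>" unfolding Inn_def by blast
        obtain v where v: "v \<in> C" using nonempty[OF CC] by blast
        have "val g C = val g' C" using const[OF CC v] eq by metis
        then show "g C = g' C" using C by (simp add: val_def)
      qed
    qed
    have "F ` (Inn \<rightarrow>\<^sub>E {1..n}) = S"
    proof (intro equalityI subsetI)
      fix m assume "m \<in> F ` (Inn \<rightarrow>\<^sub>E {1..n})"
      then obtain g where g: "g \<in> Inn \<rightarrow>\<^sub>E {1..n}" and m: "m = F g" by blast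
      have "Mid t \<in> W" if "t \<in> {1..r}" for t using that by (auto simp: W_def)
      then have "m \<in> multi_indices n r"
        unfolding multi_indices_def m using val_in[OF g cls(1)]
        by (intro PiE_I) (simp_all add: F_def del: atLeastAtMost_iff)
      moreover have "lab a m c x = lab a m c y" if "C \<in> \<C>" "x \<in> C" "y \<in> C" for C x y
        unfolding m const[OF that(1,2)] const[OF that(1,3)] ..
      ultimately show "m \<in> S" unfolding S_def by blast
    next
      fix m assume m: "m \<in> S"
      define g where "g = (\<lambda>C\<in>Inn. lab a m c (SOME v. v \<in> C))"
      have lm: "lab a m c x = lab a m c y" if "C \<in> \<C>" "x \<in> C" "y \<in> C" for C x y
        using m that unfolding S_def by blast
      have mi: "m \<in> {1..r} \<rightarrow>\<^sub>E {1..n}" using m unfolding S_def multi_indices_def by blast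
      have gv: "g C = lab a m c v" if "C \<in> Inn" "v \<in> C" for C v
      proof -
        have "(SOME v. v \<in> C) \<in> C" using that(2) by (rule someI)
        moreover have "C \<in> \<C>" using that(1) unfolding Inn_def by blast
        ultimately have "lab a m c (SOME v. v \<in> C) = lab a m c v" using lm that(2) by blast
        then show ?thesis using that(1) by (simp add: g_def)
      qed
      have "g C \<in> {1..n}" if C: "C \<in> Inn" for C
      proof -
        have CC: "C \<in> \<C>" using C unfolding Inn_def by blast
        obtain v where v: "v \<in> C" using nonempty[OF CC] by blast
        then obtain t where t: "v = Mid t" using C unfolding Inn_def by blast
        have "t \<in> {1..r}" using CW[OF CC v] t by (auto simp: W_def)
        then show ?thesis using gv[OF C v] t mi by auto
      qed
      then have g: "g \<in> Inn \<rightarrow>\<^sub>E {1..n}" unfolding g_def by auto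
      have "F g = m"
      proof
        fix t show "F g t = m t"
        proof (cases "t \<in> {1..r}")
          case False then show ?thesis using mi by (auto simp: F_def)
        next
          case t: True
          define C where "C = cls (Mid t)"
          have MW: "Mid t \<in> W" using t by (auto simp: W_def)
          have C: "C \<in> \<C>" "Mid t \<in> C" unfolding C_def using cls MW by auto
          have F: "F g t = val g C" using t by (simp add: F_def C_def)
          show ?thesis
          proof (cases "C \<in> Inn")
            case True
            then show ?thesis using F gv[OF True C(2)] by (simp add: val_def)
          next
            case False
            let ?v = "SOME v. v \<in> C \<and> v \<notin> range Mid"
            have v: "?v \<in> C - range Mid" by (rule out[OF C(1) False])
            have "val g C = lab a (\<lambda>_. 0) c ?v" using False by (simp add: val_def)
            also have "\<dots> = lab a m c ?v" using v by (cases ?v) auto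
            also have "\<dots> = lab a m c (Mid t)" using v by (intro lm[OF C(1) _ C(2)]) blast
            finally show ?thesis using F by simp
          qed
        qed
      qed
      then show "m \<in> F ` (Inn \<rightarrow>\<^sub>E {1..n})" using g by blast
    qed
    then have "card S = card (Inn \<rightarrow>\<^sub>E {1..n})" using card_image[OF inj] by simp
    also have "\<dots> = n ^ card Inn" using finC by (simp add: card_PiE Inn_def)
    finally show ?thesis unfolding S using True by (simp add: Inn_def \<C>_def loops_def)
  qed
qed

lemma diagram_op_comp:
  assumes d: "d \<in> diagrams r" and e: "e \<in> diagrams r"
  shows "diagram_op n r d (diagram_op n r e u) a
    = of_nat n ^ loops d e * diagram_op n r (diagram_comp d e) u a"
proof (cases "a \<in> multi_indices n r")
  case False
  then show ?thesis by (simp add: diagram_op_def)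
next
  case a: True
  let ?I = "multi_indices n r"
  have "diagram_op n r d (diagram_op n r e u) a
      = (\<Sum>m\<in>?I. \<Sum>b\<in>?I. if compatible d a m \<and> compatible e m b then u b else 0)"
    unfolding diagram_op_def using a by (simp, intro sum.cong refl) (auto intro!: sum.cong)
  also have "\<dots> = (\<Sum>b\<in>?I. \<Sum>m\<in>?I. if compatible d a m \<and> compatible e m b then u b else 0)"
    by (rule sum.swap)
  also have "\<dots> = (\<Sum>b\<in>?I. of_nat (card {m\<in>?I. compatible d a m \<and> compatible e m b}) * u b)"
    by (intro sum.cong refl)
       (simp add: sum.If_cases finite_multi_indices Int_def flip: sum.inter_filter)
  also have "\<dots> = (\<Sum>b\<in>?I. of_nat n ^ loops d e
      * (if compatible (diagram_comp d e) a b then u b else 0))"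
    by (intro sum.cong refl) (simp add: card_middle_labellings[OF d e a])
  finally show ?thesis using a by (simp add: diagram_op_def sum_distrib_left)
qed

lemma lookup_pa_mult:
  assumes "x \<in> partition_algebra r" "y \<in> partition_algebra r"
  shows "Poly_Mapping.lookup (pa_mult \<delta> x y) f
    = (\<Sum>d\<in>diagrams r. \<Sum>e\<in>diagrams r. if diagram_comp d e = f
        then \<delta> ^ loops d e * Poly_Mapping.lookup x d * Poly_Mapping.lookup y e else 0)"
proof -
  have k: "Poly_Mapping.keys x \<subseteq> diagrams r" "Poly_Mapping.keys y \<subseteq> diagrams r"
    using assms by (auto simp: partition_algebra_def)
  have "Poly_Mapping.lookup (pa_mult \<delta> x y) f
      = (\<Sum>d\<in>Poly_Mapping.keys x. \<Sum>e\<in>Poly_Mapping.keys y. if diagram_comp d e = f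
          then \<delta> ^ loops d e * Poly_Mapping.lookup x d * Poly_Mapping.lookup y e else 0)"
    by (simp add: pa_mult_def lookup_sum lookup_single when_def)
  also have "\<dots> = (\<Sum>d\<in>Poly_Mapping.keys x. \<Sum>e\<in>diagrams r. if diagram_comp d e = f
        then \<delta> ^ loops d e * Poly_Mapping.lookup x d * Poly_Mapping.lookup y e else 0)"
    by (intro sum.cong sum.mono_neutral_left finite_diagrams k refl) (simp add: in_keys_iff)
  also have "\<dots> = (\<Sum>d\<in>diagrams r. \<Sum>e\<in>diagrams r. if diagram_comp d e = f
        then \<delta> ^ loops d e * Poly_Mapping.lookup x d * Poly_Mapping.lookup y e else 0)"
    by (intro sum.mono_neutral_left finite_diagrams k ballI sum.neutral) (simp add: in_keys_iff)
  finally show ?thesis .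
qed

lemma diagram_op_scale: "diagram_op n r d (c \<cdot> u) a = c * diagram_op n r d u a"
  unfolding diagram_op_def tensor_scale_def
  by (simp add: sum_distrib_left if_distrib cong: if_cong)

lemma diagram_op_add: "diagram_op n r d (u + w) a = diagram_op n r d u a + diagram_op n r d w a"
  unfolding diagram_op_def by (simp add: sum.distrib[symmetric] if_distrib cong: if_cong)

lemma diagram_op_sum:
  "diagram_op n r d (\<lambda>a. \<Sum>e\<in>E. c e * f e a) a = (\<Sum>e\<in>E. c e * diagram_op n r d (f e) a)"
proof (cases "a \<in> multi_indices n r")
  case True
  have "(\<Sum>b\<in>multi_indices n r. if compatible d a b then \<Sum>e\<in>E. c e * f e b else 0)
      = (\<Sum>b\<in>multi_indices n r. \<Sum>e\<in>E. c e * (if compatible d a b then f e b else 0))"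
    by (intro sum.cong refl) simp
  also have "\<dots> = (\<Sum>e\<in>E. c e * (\<Sum>b\<in>multi_indices n r. if compatible d a b then f e b else 0))"
    by (subst sum.swap) (simp add: sum_distrib_left)
  finally show ?thesis using True by (simp add: diagram_op_def)
qed (simp add: diagram_op_def)

lemma diagram_act_mult:
  assumes x: "x \<in> partition_algebra r" and y: "y \<in> partition_algebra r"
  shows "diagram_act n r (pa_mult (of_nat n) x y) u = diagram_act n r x (diagram_act n r y u)"
proof
  fix a
  let ?D = "diagrams r" and ?x = "Poly_Mapping.lookup x" and ?y = "Poly_Mapping.lookup y"
  have "diagram_act n r (pa_mult (of_nat n) x y) u a
      = (\<Sum>f\<in>?D. \<Sum>d\<in>?D. \<Sum>e\<in>?D. if diagram_comp d e = f
          then of_nat n ^ loops d e * ?x d * ?y e * diagram_op n r f u a else 0)"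
    unfolding diagram_act_def lookup_pa_mult[OF x y] sum_distrib_right
    by (intro sum.cong refl) simp
  also have "\<dots> = (\<Sum>d\<in>?D. \<Sum>f\<in>?D. \<Sum>e\<in>?D. if diagram_comp d e = f
          then of_nat n ^ loops d e * ?x d * ?y e * diagram_op n r f u a else 0)"
    by (rule sum.swap)
  also have "\<dots> = (\<Sum>d\<in>?D. \<Sum>e\<in>?D. \<Sum>f\<in>?D. if diagram_comp d e = f
          then of_nat n ^ loops d e * ?x d * ?y e * diagram_op n r f u a else 0)"
    by (rule sum.cong[OF refl]) (rule sum.swap)
  also have "\<dots> = (\<Sum>d\<in>?D. \<Sum>e\<in>?D.
      of_nat n ^ loops d e * ?x d * ?y e * diagram_op n r (diagram_comp d e) u a)"
    by (intro sum.cong refl) (simp add: finite_diagrams diagram_comp_in_diagrams)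
  also have "\<dots> = (\<Sum>d\<in>?D. \<Sum>e\<in>?D. ?x d * (?y e * diagram_op n r d (diagram_op n r e u) a))"
    by (intro sum.cong refl) (simp add: diagram_op_comp)
  also have "\<dots> = diagram_act n r x (diagram_act n r y u) a"
    unfolding diagram_act_def diagram_op_sum by (simp add: sum_distrib_left)
  finally show "diagram_act n r (pa_mult (of_nat n) x y) u a
    = diagram_act n r x (diagram_act n r y u) a" .
qed

lemma diagram_act_single:
  assumes "d \<in> diagrams r"
  shows "diagram_act n r (Poly_Mapping.single d 1) u = diagram_op n r d u"
proof
  fix a
  have "diagram_act n r (Poly_Mapping.single d 1) u a
      = (\<Sum>e\<in>diagrams r. if d = e then diagram_op n r e u a else 0)"
    unfolding diagram_act_def by (intro sum.cong refl) (simp add: lookup_single when_def)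
  then show "diagram_act n r (Poly_Mapping.single d 1) u a = diagram_op n r d u a"
    using assms by (simp add: finite_diagrams)
qed

lemma tensor_unit_vec:
  "tensor r (\<lambda>t. unit_vec (i t)) = (\<lambda>m. if m \<in> extensional {1..r} \<and> (\<forall>t\<in>{1..r}. m t = i t) then 1 else 0)"
  unfolding tensor_def unit_vec_def by (auto simp: fun_eq_iff)

lemma diagram_op_tensor:
  assumes i: "i \<in> {1..r} \<rightarrow> {1..n}"
  shows "diagram_op n r d (tensor r (\<lambda>t. unit_vec (i t))) a
    = (if a \<in> multi_indices n r \<and> compatible d a (restrict i {1..r}) then 1 else 0)"
proof (cases "a \<in> multi_indices n r")
  case True
  have mem: "restrict i {1..r} \<in> multi_indices n r"
    using i unfolding multi_indices_def by auto
  have "(\<Sum>b\<in>multi_indices n r. if compatible d a b then tensor r (\<lambda>t. unit_vec (i t)) b else 0)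
      = (\<Sum>b\<in>multi_indices n r. if b = restrict i {1..r}
          then if compatible d a (restrict i {1..r}) then 1 else 0 else 0)"
  proof (intro sum.cong refl)
    fix b assume "b \<in> multi_indices n r"
    then have "b \<in> extensional {1..r}" unfolding multi_indices_def by (auto simp: PiE_def)
    then have "(\<forall>t\<in>{1..r}. b t = i t) \<longleftrightarrow> b = restrict i {1..r}"
      by (auto simp: fun_eq_iff extensional_def)
    then show "(if compatible d a b then tensor r (\<lambda>t. unit_vec (i t)) b else 0)
      = (if b = restrict i {1..r} then if compatible d a (restrict i {1..r}) then 1 else 0 else 0)"
      using \<open>b \<in> extensional {1..r}\<close> by (simp add: tensor_unit_vec)
  qed
  then show ?thesis using True mem by (simp add: diagram_op_def finite_multi_indices)
qed (simp add: diagram_op_def)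

lemma tensor_unit_vec':
  assumes "i \<in> {1..r} \<rightarrow> {1..n}"
  shows "tensor r (\<lambda>t. unit_vec (i t)) a
    = (if a \<in> multi_indices n r \<and> (\<forall>t\<in>{1..r}. a t = i t) then 1 else 0)"
  using assms unfolding tensor_unit_vec multi_indices_def by (auto simp: PiE_def Pi_def)

lemma partition_on_add_vertical:
  assumes "partition_on V d" "V \<inter> (Top ` M \<union> Bot ` M) = {}"
  shows "partition_on (V \<union> (Top ` M \<union> Bot ` M)) (d \<union> {{Top m, Bot m} | m. m \<in> M})"
proof -
  let ?B = "\<lambda>m. {Top m, Bot m}"
  have U: "\<Union>(?B ` M) = Top ` M \<union> Bot ` M" by auto
  have disj: "disjnt P Q" if "P \<in> d" "Q \<in> ?B ` M" for P Q
    using that assms unfolding partition_on_def disjnt_def by fast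
  have "partition_on (V \<union> (Top ` M \<union> Bot ` M)) (d \<union> ?B ` M)"
  proof (rule partition_onI)
    show "\<Union>(d \<union> ?B ` M) = V \<union> (Top ` M \<union> Bot ` M)"
      using assms(1) U unfolding partition_on_def Union_Un_distrib by (simp only:)
    show "{} \<notin> d \<union> ?B ` M"
      using assms(1) unfolding partition_on_def by auto
    fix P Q assume "P \<in> d \<union> ?B ` M" "Q \<in> d \<union> ?B ` M" and "P \<noteq> Q"
    from this(1,2) show "disjnt P Q"
    proof (elim UnE)
      assume "P \<in> d" "Q \<in> d"
      then show ?thesis using \<open>P \<noteq> Q\<close> assms(1) unfolding partition_on_def by (metis pairwiseD)
    next
      assume "P \<in> d" "Q \<in> ?B ` M"
      then show ?thesis by (rule disj)
    next
      assume "P \<in> ?B ` M" "Q \<in> d"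
      then show ?thesis using disj[of Q P] disjnt_sym by blast
    next
      assume "P \<in> ?B ` M" "Q \<in> ?B ` M"
      then show ?thesis using \<open>P \<noteq> Q\<close> by (auto simp: disjnt_def)
    qed
  qed
  moreover have "{?B m | m. m \<in> M} = ?B ` M" by auto
  ultimately show ?thesis by (simp only:)
qed

lemma diagrams_add_vertical:
  assumes "partition_on V d" "V \<inter> (Top ` M \<union> Bot ` M) = {}"
    and "V \<union> (Top ` M \<union> Bot ` M) = Top ` {1..r} \<union> Bot ` {1..r}"
  shows "d \<union> {{Top m, Bot m} | m. m \<in> M} \<in> diagrams r"
  using partition_on_add_vertical[OF assms(1,2)] unfolding assms(3) diagrams_def mem_Collect_eq .

lemma id_diagram: "id_diagram r \<in> diagrams r"
  using partition_on_add_vertical[of "{}" "{}" "{1..r}"]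
  by (simp add: diagrams_def id_diagram_def partition_on_empty)

lemma s_diagram: "1 \<le> k \<Longrightarrow> k + 1 \<le> r \<Longrightarrow> s_diagram r k \<in> diagrams r"
proof -
  assume k: "1 \<le> k" "k + 1 \<le> r"
  let ?V = "{Top k, Top (k + 1), Bot k, Bot (k + 1)}" and ?M = "{1..r} - {k, k + 1}"
  have "partition_on ?V {{Top k, Bot (k + 1)}, {Top (k + 1), Bot k}}"
    by (rule partition_onI) (auto simp: disjnt_def)
  moreover have "?V \<inter> (Top ` ?M \<union> Bot ` ?M) = {}" by auto
  moreover have "?V \<union> (Top ` ?M \<union> Bot ` ?M) = Top ` {1..r} \<union> Bot ` {1..r}" using k by auto
  ultimately show ?thesis
    unfolding s_diagram_def by (rule diagrams_add_vertical)
qed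

lemma p_diagram: "1 \<le> k \<Longrightarrow> k \<le> r \<Longrightarrow> p_diagram r k \<in> diagrams r"
proof -
  assume k: "1 \<le> k" "k \<le> r"
  let ?V = "{Top k, Bot k}" and ?M = "{1..r} - {k}"
  have "partition_on ?V {{Top k}, {Bot k}}"
    by (rule partition_onI) (auto simp: disjnt_def)
  moreover have "?V \<inter> (Top ` ?M \<union> Bot ` ?M) = {}" by auto
  moreover have "?V \<union> (Top ` ?M \<union> Bot ` ?M) = Top ` {1..r} \<union> Bot ` {1..r}" using k by auto
  ultimately show ?thesis
    unfolding p_diagram_def by (rule diagrams_add_vertical)
qed

lemma p_half_diagram: "1 \<le> k \<Longrightarrow> k + 1 \<le> r \<Longrightarrow> p_half_diagram r k \<in> diagrams r"
proof -
  assume k: "1 \<le> k" "k + 1 \<le> r"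
  let ?V = "{Top k, Top (k + 1), Bot k, Bot (k + 1)}" and ?M = "{1..r} - {k, k + 1}"
  have "partition_on ?V {?V}" by (rule partition_on_space) simp
  moreover have "?V \<inter> (Top ` ?M \<union> Bot ` ?M) = {}" by auto
  moreover have "?V \<union> (Top ` ?M \<union> Bot ` ?M) = Top ` {1..r} \<union> Bot ` {1..r}" using k by auto
  ultimately show ?thesis
    unfolding p_half_diagram_def by (rule diagrams_add_vertical)
qed

lemma compatible_Un: "compatible (d \<union> e) a b \<longleftrightarrow> compatible d a b \<and> compatible e a b"
  unfolding compatible_def by (rule ball_Un)

lemma compatible_vertical:
  "compatible {{Top m, Bot m} | m. m \<in> M} a b \<longleftrightarrow> (\<forall>m\<in>M. a m = b m)"
proof -
  have "{{Top m, Bot m} | m. m \<in> M} = (\<lambda>m. {Top m, Bot m}) ` M" by auto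
  then show ?thesis by (auto simp: compatible_def)
qed

lemma compatible_half_block:
  "compatible {{Top k, Top l, Bot k, Bot l}} a b \<longleftrightarrow> a k = a l \<and> a k = b k \<and> a k = b l"
  unfolding compatible_def by (simp only: ball_simps lab.simps) metis

lemma compatible_crossing:
  "compatible {{Top k, Bot l}, {Top l, Bot k}} a b \<longleftrightarrow> a k = b l \<and> a l = b k"
  unfolding compatible_def by (simp only: ball_simps lab.simps) metis

lemma sum_fun_apply: "(\<Sum>j\<in>A. f j) x = (\<Sum>j\<in>A. f j x)"
  by (induction A rule: infinite_finite_induct) auto

theorem tensor_action_exists: "tensor_action n r (diagram_act n r)"
proof
  show "diagram_act n r x u \<in> tensor_space n r" for x u
    unfolding diagram_act_def tensor_space_def diagram_op_def by auto
  show "diagram_act n r x (u + w) = diagram_act n r x u + diagram_act n r x w" for x u w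
    unfolding diagram_act_def by (rule ext) (simp add: diagram_op_add algebra_simps sum.distrib)
  show "diagram_act n r x (c \<cdot> u) = c \<cdot> diagram_act n r x u" for x c u
    unfolding diagram_act_def diagram_op_scale
    by (rule ext) (simp add: tensor_scale_def sum_distrib_left mult_ac)
  show "diagram_act n r (x + y) u = diagram_act n r x u + diagram_act n r y u" for x y u
    unfolding diagram_act_def by (rule ext) (simp add: lookup_add algebra_simps sum.distrib)
  show "diagram_act n r (pa_scale c x) u = c \<cdot> diagram_act n r x u" for c x u
    unfolding diagram_act_def
    by (rule ext)
       (auto simp: tensor_scale_def sum_distrib_left Poly_Mapping.map.rep_eq when_def mult_ac intro!: sum.cong)
  show "diagram_act n r (pa_mult (of_nat n) x y) u = diagram_act n r x (diagram_act n r y u)"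
    if "x \<in> partition_algebra r" "y \<in> partition_algebra r" for x y u
    by (rule diagram_act_mult[OF that])
  show "diagram_act n r (pa_one r) u = u" if u: "u \<in> tensor_space n r" for u
  proof
    fix a
    show "diagram_act n r (pa_one r) u a = u a"
    proof (cases "a \<in> multi_indices n r")
      case False
      then show ?thesis using u
        by (simp add: pa_one_def diagram_act_single[OF id_diagram] diagram_op_def tensor_space_def)
    next
      case True
      have "compatible (id_diagram r) a b \<longleftrightarrow> a = b" if "b \<in> multi_indices n r" for b
        using True that unfolding id_diagram_def compatible_vertical multi_indices_def
        by (auto intro: PiE_ext)
      then have "(\<Sum>b\<in>multi_indices n r. if compatible (id_diagram r) a b then u b else 0)
          = (\<Sum>b\<in>multi_indices n r. if a = b then u b else 0)"
        by (intro sum.cong refl) simp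
      then show ?thesis using True
        by (simp add: pa_one_def diagram_act_single[OF id_diagram] diagram_op_def finite_multi_indices)
    qed
  qed
next
  fix k i assume k: "1 \<le> k" "k + 1 \<le> r" and i: "i \<in> {1..r} \<rightarrow> {1..n}"
  let ?s = "transpose k (k + 1)"
  have s: "?s t \<in> {1..r} \<longleftrightarrow> t \<in> {1..r}" for t
    using k by (auto simp: transpose_def)
  have i': "(\<lambda>t. i (?s t)) \<in> {1..r} \<rightarrow> {1..n}"
    using i s by blast
  have "compatible (s_diagram r k) a (restrict i {1..r}) \<longleftrightarrow> (\<forall>t\<in>{1..r}. a t = i (?s t))" for a
  proof -
    have "compatible (s_diagram r k) a (restrict i {1..r}) \<longleftrightarrow>
        a k = i (k + 1) \<and> a (k + 1) = i k \<and> (\<forall>t\<in>{1..r} - {k, k + 1}. a t = i t)"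
      unfolding s_diagram_def compatible_Un compatible_vertical compatible_crossing
      using k by simp
    also have "\<dots> \<longleftrightarrow> (\<forall>t\<in>{1..r}. a t = i (?s t))"
    proof (intro iffI conjI ballI; (elim conjE)?)
      fix t assume "a k = i (k + 1)" "a (k + 1) = i k" "t \<in> {1..r}"
        and "\<forall>t\<in>{1..r} - {k, k + 1}. a t = i t"
      then show "a t = i (?s t)" by (cases "t = k"; cases "t = k + 1") simp_all
    next
      assume *: "\<forall>t\<in>{1..r}. a t = i (?s t)"
      have "k \<in> {1..r}" "k + 1 \<in> {1..r}" using k by auto
      then show "a k = i (k + 1)" "a (k + 1) = i k"
        using * by (simp_all only: transpose_apply_first transpose_apply_second)
      show "a t = i t" if "t \<in> {1..r} - {k, k + 1}" for t
        using * that by simp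
    qed
    finally show ?thesis .
  qed
  then show "diagram_act n r (gen_s r k) (tensor r (\<lambda>t. unit_vec (i t)))
      = tensor r (\<lambda>t. unit_vec (i (?s t)))"
    unfolding gen_s_def diagram_act_single[OF s_diagram[OF k]]
    by (intro ext) (simp only: diagram_op_tensor[OF i] tensor_unit_vec'[OF i'])
next
  fix k i assume k: "1 \<le> k" "k + 1 \<le> r" and i: "i \<in> {1..r} \<rightarrow> {1..n}"
  have "compatible (p_half_diagram r k) a (restrict i {1..r}) \<longleftrightarrow>
      i k = i (k + 1) \<and> (\<forall>t\<in>{1..r}. a t = i t)" for a
  proof -
    have "compatible (p_half_diagram r k) a (restrict i {1..r}) \<longleftrightarrow>
        a k = a (k + 1) \<and> a k = i k \<and> a k = i (k + 1) \<and> (\<forall>t\<in>{1..r} - {k, k + 1}. a t = i t)"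
      unfolding p_half_diagram_def compatible_Un compatible_vertical compatible_half_block
      using k by simp
    also have "\<dots> \<longleftrightarrow> i k = i (k + 1) \<and> (\<forall>t\<in>{1..r}. a t = i t)"
    proof (intro iffI conjI ballI; elim conjE)
      fix t assume "a k = a (k + 1)" "a k = i k" "a k = i (k + 1)" "t \<in> {1..r}"
        and "\<forall>t\<in>{1..r} - {k, k + 1}. a t = i t"
      then show "a t = i t" by (cases "t \<in> {k, k + 1}") auto
    next
      assume "i k = i (k + 1)" "\<forall>t\<in>{1..r}. a t = i t"
      moreover have "k \<in> {1..r}" "k + 1 \<in> {1..r}" using k by auto
      ultimately show "a k = a (k + 1)" "a k = i k" "a k = i (k + 1)" by metis+
    qed auto
    finally show ?thesis .
  qed
  then show "diagram_act n r (gen_p_half r k) (tensor r (\<lambda>t. unit_vec (i t)))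
      = (if i k = i (k + 1) then tensor r (\<lambda>t. unit_vec (i t)) else 0)"
    unfolding gen_p_half_def diagram_act_single[OF p_half_diagram[OF k]]
    by (intro ext, cases "i k = i (k + 1)")
       (simp_all only: diagram_op_tensor[OF i] tensor_unit_vec'[OF i] if_True if_False simp_thms zero_fun_apply)
next
  fix k i assume k: "1 \<le> k" "k \<le> r" and i: "i \<in> {1..r} \<rightarrow> {1..n}"
  have comp: "compatible (p_diagram r k) a (restrict i {1..r}) \<longleftrightarrow>
      (\<forall>t\<in>{1..r} - {k}. a t = i t)" for a
  proof -
    have "compatible {{Top k}, {Bot k}} a (restrict i {1..r})"
      by (simp add: compatible_def)
    then show ?thesis
      unfolding p_diagram_def compatible_Un compatible_vertical by simp
  qed
  show "diagram_act n r (gen_p r k) (tensor r (\<lambda>t. unit_vec (i t)))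
      = (\<Sum>j=1..n. tensor r (\<lambda>t. if t = k then unit_vec j else unit_vec (i t)))"
  proof
    fix a
    let ?c = "a \<in> multi_indices n r \<and> (\<forall>t\<in>{1..r} - {k}. a t = i t)"
    have j: "tensor r (\<lambda>t. if t = k then unit_vec j else unit_vec (i t)) a
        = (if j = a k then if ?c then 1 else 0 else 0)" if "j \<in> {1..n}" for j
    proof -
      have i': "i(k := j) \<in> {1..r} \<rightarrow> {1..n}" using i that by auto
      have "(\<lambda>t. if t = k then unit_vec j else unit_vec (i t)) = (\<lambda>t. unit_vec ((i(k := j)) t))"
        by auto
      then have "tensor r (\<lambda>t. if t = k then unit_vec j else unit_vec (i t)) a
          = (if a \<in> multi_indices n r \<and> (\<forall>t\<in>{1..r}. a t = (i(k := j)) t) then 1 else 0)"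
        by (simp only: tensor_unit_vec'[OF i'])
      moreover have "(\<forall>t\<in>{1..r}. a t = (i(k := j)) t) \<longleftrightarrow> j = a k \<and> (\<forall>t\<in>{1..r} - {k}. a t = i t)"
        using k by auto
      ultimately show ?thesis by auto
    qed
    have "(\<Sum>j=1..n. tensor r (\<lambda>t. if t = k then unit_vec j else unit_vec (i t))) a
        = (\<Sum>j=1..n. if j = a k then if ?c then 1 else 0 else 0)"
      by (simp only: sum_fun_apply j cong: sum.cong)
    also have "\<dots> = (if ?c then 1 else 0)"
      using k by (auto simp: multi_indices_def)
    finally show "diagram_act n r (gen_p r k) (tensor r (\<lambda>t. unit_vec (i t))) a
      = (\<Sum>j=1..n. tensor r (\<lambda>t. if t = k then unit_vec j else unit_vec (i t))) a"
      by (simp only: gen_p_def diagram_act_single[OF p_diagram[OF k]] diagram_op_tensor[OF i] comp)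
  qed
qed

end

theory Submission
  imports Defs
begin

text \<open>
  Only the operators of the generators are given, but every element in the recursions is a polynomial
  in generators. On a basis word the generators act locally: they exchange two neighbouring letters,
  test two neighbours for equality, or sum over one letter. So the recursions can be followed letter
  by letter, as soon as one knows what the $\sigma$'s do. The formulas that make the induction close
  are, for a word \<open>w\<close> followed by letters \<open>a\<close>, \<open>b\<close> in positions $k$, $k+1$,
  $$\sigma_{k+\frac12}(w \otimes a \otimes b) = s_{a,b}w \otimes a \otimes b, \qquad
    \sigma_{k+1}(w \otimes a \otimes b) = s_{a,b}w \otimes b \otimes a:$$
  the first moves only the letters to the left of position $k$, and the second is the diagonal action
  of the transposition $s_{a,b}$.

  In each recursion the conjugate of the previous element gives the right answer except that the
  letter just passed is not moved. A transposition moves this letter only if it is one of the two that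
  are exchanged, and the projections $p_{i+\frac12}$ in the remaining terms pick out exactly the words
  in which such a coincidence occurs.
  The step lemmas \<open>acts_as_sigma_step\<close>, \<open>acts_as_sigma_half_step\<close>, \<open>acts_as_L_step\<close> and
  \<open>acts_as_L_half_step\<close> make this precise. The formula for $L_{k+1}$ follows from those for $L_k$
  and $\sigma_{k+1}$, and the one for $\sigma_{k+2}$ from those for $\sigma_{k+1}$ and $L_k$, so a
  single induction proves both families; the half-integer families come afterwards.

  The recursions mix elements on different numbers of strands, while the tensor space has a fixed
  number \<open>r\<close> of factors. All elements are therefore made to act on $V^{\otimes r}$ by
  \<open>strand_act\<close>, which adds vertical strands and sets $z = n$ at once. That this is multiplicative
  rests on the fact that vertical strands create neither new identifications nor deleted components
  (\<open>stacked_extend\<close>).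
\<close>

section \<open>Adding vertical strands\<close>

text \<open>
  A path cannot leave the vertices of the subgraph in which it starts, because no edge joins two of
  the subgraphs.
\<close>

lemma graph_components_UN_disjoint:
  assumes disj: "\<And>i j. i \<in> I \<Longrightarrow> j \<in> I \<Longrightarrow> i \<noteq> j \<Longrightarrow> \<Union>(F i) \<inter> \<Union>(F j) = {}"
  shows "graph_components (\<Union>i\<in>I. F i) = (\<Union>i\<in>I. graph_components (F i))"
proof -
  define E where "E \<B> = (\<Union>B\<in>\<B>. B \<times> B)" for \<B> :: "vertex set set"
  have stay: "y \<in> \<Union>(F i) \<and> (x, y) \<in> (E (F i))\<^sup>+"
    if xy: "(x, y) \<in> (E (\<Union>i\<in>I. F i))\<^sup>+" and i: "i \<in> I" and x: "x \<in> \<Union>(F i)" for i x y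
  proof -
    have edge: "(y, z) \<in> E (F i) \<and> z \<in> \<Union>(F i)"
      if yz: "(y, z) \<in> E (\<Union>i\<in>I. F i)" and y: "y \<in> \<Union>(F i)" for y z
    proof -
      obtain j B where B: "j \<in> I" "B \<in> F j" "y \<in> B" "z \<in> B"
        using yz unfolding E_def by blast
      then have "y \<in> \<Union>(F i) \<inter> \<Union>(F j)" using y by blast
      then have "j = i" using disj[OF i B(1)] by blast
      then show ?thesis using B unfolding E_def by blast
    qed
    from xy show ?thesis
    proof (induction rule: trancl_induct)
      case (base y)
      then show ?case using edge[OF base x] by blast
    next
      case (step y z)
      then show ?case using edge by (meson trancl_into_trancl)
    qed
  qed
  have class_eq: "(E (\<Union>i\<in>I. F i))\<^sup>+ `` {x} = (E (F i))\<^sup>+ `` {x}"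
    if "i \<in> I" "x \<in> \<Union>(F i)" for i x
  proof -
    have "E (F i) \<subseteq> E (\<Union>i\<in>I. F i)" using that(1) unfolding E_def by blast
    then have "(E (F i))\<^sup>+ \<subseteq> (E (\<Union>i\<in>I. F i))\<^sup>+" by (rule trancl_mono_subset)
    then show ?thesis using stay[OF _ that] by blast
  qed
  have "graph_components (\<Union>i\<in>I. F i) =
      (\<Union>i\<in>I. \<Union>x\<in>\<Union>(F i). {(E (\<Union>i\<in>I. F i))\<^sup>+ `` {x}})"
    unfolding graph_components_def quotient_def E_def by blast
  also have "\<dots> = (\<Union>i\<in>I. \<Union>x\<in>\<Union>(F i). {(E (F i))\<^sup>+ `` {x}})"
    by (intro SUP_cong refl) (simp only: class_eq)
  also have "\<dots> = (\<Union>i\<in>I. graph_components (F i))"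
    unfolding graph_components_def quotient_def E_def by blast
  finally show ?thesis .
qed

lemma graph_components_Un_disjoint:
  assumes "\<Union>\<A> \<inter> \<Union>\<B> = {}"
  shows "graph_components (\<A> \<union> \<B>) = graph_components \<A> \<union> graph_components \<B>"
proof -
  let ?F = "\<lambda>b. if b then \<A> else \<B>"
  have "graph_components (\<Union>b. ?F b) = (\<Union>b. graph_components (?F b))"
    by (rule graph_components_UN_disjoint) (use assms in auto)
  then show ?thesis by (simp add: UNIV_bool Un_commute)
qed

text \<open>
  Any two vertices are joined by a path through the common vertex \<open>b\<close>.
\<close>

lemma graph_components_star:
  assumes "\<B> \<noteq> {}" and hub: "\<And>B. B \<in> \<B> \<Longrightarrow> b \<in> B"
  shows "graph_components \<B> = {\<Union>\<B>}"
proof -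
  let ?E = "\<Union>B\<in>\<B>. B \<times> B"
  have "?E\<^sup>+ `` {x} = \<Union>\<B>" if "x \<in> \<Union>\<B>" for x
  proof
    show "?E\<^sup>+ `` {x} \<subseteq> \<Union>\<B>"
      using trancl_subset_Sigma[of ?E "\<Union>\<B>"] by blast
    show "\<Union>\<B> \<subseteq> ?E\<^sup>+ `` {x}"
    proof
      fix y assume "y \<in> \<Union>\<B>"
      then have "(x, b) \<in> ?E" "(b, y) \<in> ?E" using that hub by blast+
      then show "y \<in> ?E\<^sup>+ `` {x}" by (auto intro: trancl_trans)
    qed
  qed
  moreover have "\<Union>\<B> \<noteq> {}" using assms by blast
  ultimately show ?thesis unfolding graph_components_def quotient_def by auto
qed

text \<open>
  Each added strand contributes a component of its own, which meets the outer rows and so is never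
  deleted.
\<close>

lemma stacked_extend:
  assumes d: "d \<in> diagrams k" and e: "e \<in> diagrams k"
  shows "stacked (extend_diagram k r d) (extend_diagram k r e)
    = stacked d e \<union> (\<lambda>m. {Top m, Mid m, Bot m}) ` {k<..r}"
proof -
  \<comment> \<open>The upper and the lower half of the added strand \<open>m\<close>; they meet in \<open>Mid m\<close>.\<close>
  define F where "F m = {{Top m, Mid m}, {Mid m, Bot m}}" for m
  define \<B> where "\<B> = (`) to_upper ` d \<union> (`) to_lower ` e"
  have "(`) to_upper ` extend_diagram k r d \<union> (`) to_lower ` extend_diagram k r e
      = \<B> \<union> (\<Union>m\<in>{k<..r}. F m)"
  proof -
    have "{{Top m, Bot m} | m. m \<in> {k<..r}} = (\<lambda>m. {Top m, Bot m}) ` {k<..r}" by auto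
    then show ?thesis
      unfolding extend_diagram_def \<B>_def F_def by (auto simp: image_Un image_image)
  qed
  moreover have "\<Union>\<B> \<inter> \<Union>(\<Union>m\<in>{k<..r}. F m) = {}"
  proof -
    have "\<Union>\<B> = to_upper ` \<Union>d \<union> to_lower ` \<Union>e" unfolding \<B>_def by auto
    also have "\<dots> \<subseteq> Top ` {1..k} \<union> Mid ` {1..k} \<union> Bot ` {1..k}"
      using d e by (simp add: diagrams_def partition_on_def image_Un image_image) auto
    finally show ?thesis unfolding F_def by auto
  qed
  moreover have "graph_components (\<Union>m\<in>{k<..r}. F m) = (\<Union>m\<in>{k<..r}. graph_components (F m))"
    by (rule graph_components_UN_disjoint) (auto simp: F_def)
  moreover have "graph_components (F m) = {{Top m, Mid m, Bot m}}" for m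
    by (subst graph_components_star[of _ "Mid m"]) (auto simp: F_def)
  ultimately show ?thesis
    unfolding stacked_def \<B>_def[symmetric] by (auto simp: graph_components_Un_disjoint)
qed

lemma diagram_comp_extend:
  assumes "d \<in> diagrams k" "e \<in> diagrams k"
  shows "diagram_comp (extend_diagram k r d) (extend_diagram k r e)
    = extend_diagram k r (diagram_comp d e)"
proof -
  let ?g = "\<lambda>m. {Top m, Mid m, Bot m}" and ?cut = "\<lambda>C. C - range Mid"
  have "{C \<in> stacked d e \<union> ?g ` {k<..r}. \<not> C \<subseteq> range Mid}
      = {C \<in> stacked d e. \<not> C \<subseteq> range Mid} \<union> ?g ` {k<..r}"
    by auto
  then have "?cut ` {C \<in> stacked d e \<union> ?g ` {k<..r}. \<not> C \<subseteq> range Mid}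
      = diagram_comp d e \<union> (\<lambda>m. ?cut (?g m)) ` {k<..r}"
    by (simp only: diagram_comp_def image_Un image_image)
  also have "(\<lambda>m. ?cut (?g m)) = (\<lambda>m. {Top m, Bot m})"
    by (rule ext) auto
  also have "diagram_comp d e \<union> (\<lambda>m. {Top m, Bot m}) ` {k<..r} = extend_diagram k r (diagram_comp d e)"
    unfolding extend_diagram_def by auto
  finally show ?thesis
    unfolding diagram_comp_def[of "extend_diagram k r d"] stacked_extend[OF assms] .
qed

lemma loops_extend:
  assumes "d \<in> diagrams k" "e \<in> diagrams k"
  shows "loops (extend_diagram k r d) (extend_diagram k r e) = loops d e"
  unfolding loops_def stacked_extend[OF assms] by (rule arg_cong[of _ _ card]) auto

lemma extend_diagram_in_diagrams:
  assumes "d \<in> diagrams k" "k \<le> r"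
  shows "extend_diagram k r d \<in> diagrams r"
proof -
  let ?V = "Top ` {1..k} \<union> Bot ` {1..k}"
  have "?V \<inter> (Top ` {k<..r} \<union> Bot ` {k<..r}) = {}" by auto
  moreover have "{1..r} = {1..k} \<union> {k<..r}" using assms(2) by auto
  then have "?V \<union> (Top ` {k<..r} \<union> Bot ` {k<..r}) = Top ` {1..r} \<union> Bot ` {1..r}" by auto
  moreover have "partition_on ?V d" using assms(1) by (simp add: diagrams_def)
  ultimately show ?thesis
    unfolding extend_diagram_def by (intro diagrams_add_vertical)
qed

lemma extend_diagram_self [simp]: "extend_diagram k k d = d"
  by (simp add: extend_diagram_def)

lemma extend_diagram_trans:
  assumes "j \<le> k" "k \<le> r"
  shows "extend_diagram k r (extend_diagram j k d) = extend_diagram j r d"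
proof -
  have "{j<..r} = {j<..k} \<union> {k<..r}" using assms by auto
  then show ?thesis unfolding extend_diagram_def by auto
qed

text \<open>
  The part of a generator outside the positions \<open>J\<close> that it affects consists of vertical strands, so
  adding further strands gives the generator of the same name.
\<close>

lemma vertical_strands_split:
  assumes "J \<subseteq> {1..k}" "k \<le> r"
  shows "{{Top m, Bot m} | m. m \<in> {1..k} - J} \<union> {{Top m, Bot m} | m. m \<in> {k<..r}}
    = {{Top m, Bot m} | m. m \<in> {1..r} - J}"
proof -
  have "{1..r} - J = ({1..k} - J) \<union> {k<..r}" using assms by auto
  then show ?thesis by auto
qed

lemma extend_id_diagram: "k \<le> r \<Longrightarrow> extend_diagram k r (id_diagram k) = id_diagram r"
  using vertical_strands_split[of "{}" k r]
  by (simp add: extend_diagram_def id_diagram_def)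

lemma extend_s_diagram:
  "1 \<le> i \<Longrightarrow> i + 1 \<le> k \<Longrightarrow> k \<le> r \<Longrightarrow> extend_diagram k r (s_diagram k i) = s_diagram r i"
  using vertical_strands_split[of "{i, i + 1}" k r]
  by (simp add: extend_diagram_def s_diagram_def Un_assoc)

lemma extend_p_diagram:
  "1 \<le> i \<Longrightarrow> i \<le> k \<Longrightarrow> k \<le> r \<Longrightarrow> extend_diagram k r (p_diagram k i) = p_diagram r i"
  using vertical_strands_split[of "{i}" k r]
  by (simp add: extend_diagram_def p_diagram_def Un_assoc)

lemma extend_p_half_diagram:
  "1 \<le> i \<Longrightarrow> i + 1 \<le> k \<Longrightarrow> k \<le> r \<Longrightarrow>
    extend_diagram k r (p_half_diagram k i) = p_half_diagram r i"
  using vertical_strands_split[of "{i, i + 1}" k r]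
  by (simp add: extend_diagram_def p_half_diagram_def Un_assoc)

section \<open>Elements of the partition algebra\<close>

lemma zero_in_partition_algebra [simp]: "0 \<in> partition_algebra k"
  by (simp add: partition_algebra_def)

lemma uminus_in_partition_algebra [simp]:
  "x \<in> partition_algebra k \<Longrightarrow> - x \<in> partition_algebra k"
  by (simp add: partition_algebra_def subset_eq in_keys_iff)

lemma add_in_partition_algebra [simp]:
  "x \<in> partition_algebra k \<Longrightarrow> y \<in> partition_algebra k \<Longrightarrow> x + y \<in> partition_algebra k"
  unfolding partition_algebra_def using Poly_Mapping.keys_add[of x y] by blast

lemma diff_in_partition_algebra [simp]:
  "x \<in> partition_algebra k \<Longrightarrow> y \<in> partition_algebra k \<Longrightarrow> x - y \<in> partition_algebra k"
  using add_in_partition_algebra[of x k "- y"] by simp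

lemma single_in_partition_algebra:
  "d \<in> diagrams k \<Longrightarrow> Poly_Mapping.single d c \<in> partition_algebra k"
  by (simp add: partition_algebra_def)

lemma sum_in_partition_algebra:
  "(\<And>a. a \<in> A \<Longrightarrow> f a \<in> partition_algebra k) \<Longrightarrow> (\<Sum>a\<in>A. f a) \<in> partition_algebra k"
  by (induction A rule: infinite_finite_induct) auto

lemma pa_mult_in_partition_algebra [simp]:
  "x \<in> partition_algebra k \<Longrightarrow> y \<in> partition_algebra k \<Longrightarrow> pa_mult \<delta> x y \<in> partition_algebra k"
  unfolding pa_mult_def
  by (intro sum_in_partition_algebra single_in_partition_algebra diagram_comp_in_diagrams)
     (auto simp: partition_algebra_def)

lemma pa_embed_in_partition_algebra [simp]:
  "x \<in> partition_algebra k \<Longrightarrow> k \<le> r \<Longrightarrow> pa_embed k r x \<in> partition_algebra r"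
  unfolding pa_embed_def
  by (intro sum_in_partition_algebra single_in_partition_algebra extend_diagram_in_diagrams)
     (auto simp: partition_algebra_def)

lemma pa_one_in_partition_algebra [simp]: "pa_one k \<in> partition_algebra k"
  by (simp add: pa_one_def single_in_partition_algebra id_diagram)

lemma gen_s_in_partition_algebra [simp]:
  "1 \<le> i \<Longrightarrow> i + 1 \<le> k \<Longrightarrow> gen_s k i \<in> partition_algebra k"
  unfolding gen_s_def by (intro single_in_partition_algebra s_diagram)

lemma gen_p_in_partition_algebra [simp]:
  "1 \<le> i \<Longrightarrow> i \<le> k \<Longrightarrow> gen_p k i \<in> partition_algebra k"
  unfolding gen_p_def by (intro single_in_partition_algebra p_diagram)

lemma gen_p_half_in_partition_algebra [simp]:
  "1 \<le> i \<Longrightarrow> i + 1 \<le> k \<Longrightarrow> gen_p_half k i \<in> partition_algebra k"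
  unfolding gen_p_half_def by (intro single_in_partition_algebra p_half_diagram)

lemma L_int_sigma_int_in_partition_algebra:
  "L_int k \<in> partition_algebra k" "1 \<le> l \<Longrightarrow> sigma_int l \<in> partition_algebra l"
proof (induction k and l rule: L_int_sigma_int.induct)
qed (simp_all add: L_step_def sigma_step_def Let_def numeral_2_eq_2)

lemma sigma_half_in_partition_algebra: "1 \<le> k \<Longrightarrow> sigma_half k \<in> partition_algebra k"
  by (induction k rule: sigma_half.induct)
     (simp_all add: sigma_half_step_def Let_def numeral_2_eq_2 L_int_sigma_int_in_partition_algebra)

lemma L_half_in_partition_algebra: "1 \<le> k \<Longrightarrow> L_half k \<in> partition_algebra k"
  by (induction k rule: L_half.induct)
     (simp_all add: L_half_step_def Let_def L_int_sigma_int_in_partition_algebra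
        sigma_half_in_partition_algebra)

section \<open>Evaluation at \<open>z = n\<close>\<close>

text \<open>
  The homomorphism from $\mathbb{Z}[z]$ to $\mathbb{C}$ along which scalars are extended.
\<close>

definition eval_at :: "nat \<Rightarrow> int poly \<Rightarrow> complex" where
  "eval_at n q = poly (map_poly of_int q) (of_nat n)"

lemma eval_at_pCons: "eval_at n (pCons c q) = of_int c + of_nat n * eval_at n q"
  by (simp add: eval_at_def map_poly_pCons)

lemma eval_at_0 [simp]: "eval_at n 0 = 0"
  by (simp add: eval_at_def)

lemma eval_at_1 [simp]: "eval_at n 1 = 1"
  by (simp add: one_pCons eval_at_pCons)

lemma eval_at_add: "eval_at n (p + q) = eval_at n p + eval_at n q"
proof -
  have "map_poly of_int (p + q) = (map_poly of_int p + map_poly of_int q :: complex poly)"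
    by (rule poly_eqI) (simp add: coeff_map_poly)
  then show ?thesis by (simp add: eval_at_def)
qed

lemma eval_at_smult: "eval_at n (smult c q) = of_int c * eval_at n q"
  by (simp add: eval_at_def map_poly_smult)

lemma eval_at_mult: "eval_at n (p * q) = eval_at n p * eval_at n q"
  by (induction p)
     (simp_all add: eval_at_add eval_at_smult eval_at_pCons algebra_simps)

lemma eval_at_uminus: "eval_at n (- q) = - eval_at n q"
  using eval_at_add[of n q "- q"] by (simp add: eq_neg_iff_add_eq_0 add.commute)

lemma eval_at_z_power: "eval_at n ([:0, 1:] ^ l) = of_nat n ^ l"
  by (induction l) (simp_all add: eval_at_mult eval_at_pCons)

lemma lookup_specialize:
  "Poly_Mapping.lookup (specialize n x) d = eval_at n (Poly_Mapping.lookup x d)"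
  unfolding specialize_def eval_at_def by (simp add: Poly_Mapping.map.rep_eq when_def)

section \<open>Operators on tensor space\<close>

lemma lookup_pa_embed:
  assumes "x \<in> partition_algebra j"
  shows "Poly_Mapping.lookup (pa_embed j k x) f
    = (\<Sum>d\<in>diagrams j. if extend_diagram j k d = f then Poly_Mapping.lookup x d else 0)"
proof -
  have "Poly_Mapping.lookup (pa_embed j k x) f
      = (\<Sum>d\<in>Poly_Mapping.keys x. if extend_diagram j k d = f then Poly_Mapping.lookup x d else 0)"
    by (simp add: pa_embed_def lookup_sum lookup_single when_def)
  also have "\<dots> = (\<Sum>d\<in>diagrams j. if extend_diagram j k d = f then Poly_Mapping.lookup x d else 0)"
    using assms
    by (intro sum.mono_neutral_left finite_diagrams)
       (auto simp: partition_algebra_def in_keys_iff)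
  finally show ?thesis .
qed

lemma eval_at_sum: "eval_at n (\<Sum>a\<in>A. f a) = (\<Sum>a\<in>A. eval_at n (f a))"
  by (induction A rule: infinite_finite_induct) (simp_all add: eval_at_add)

lemma tensor_scale_scale: "a \<cdot> b \<cdot> u = (a * b) \<cdot> u"
  by (simp add: tensor_scale_def mult_ac)

lemma tensor_scale_zero [simp]: "0 \<cdot> u = 0"
  by (simp add: tensor_scale_def fun_eq_iff)

lemma tensor_scale_one [simp]: "1 \<cdot> u = u"
  by (simp add: tensor_scale_def)

lemma tensor_scale_zero_right [simp]: "c \<cdot> 0 = 0"
  by (simp add: tensor_scale_def fun_eq_iff)

lemma tensor_scale_add_left: "(a + b) \<cdot> u = a \<cdot> u + b \<cdot> u"
  by (simp add: tensor_scale_def fun_eq_iff algebra_simps)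

lemma tensor_scale_add_right: "c \<cdot> (u + v) = c \<cdot> u + c \<cdot> v"
  by (simp add: tensor_scale_def fun_eq_iff algebra_simps)

lemma tensor_scale_uminus_left: "(- a) \<cdot> u = - (a \<cdot> u)"
  by (simp add: tensor_scale_def fun_eq_iff)

lemma tensor_scale_sum_left: "(\<Sum>a\<in>A. c a) \<cdot> u = (\<Sum>a\<in>A. c a \<cdot> u)"
  by (induction A rule: infinite_finite_induct) (simp_all add: tensor_scale_add_left)

lemma tensor_scale_sum_right: "c \<cdot> (\<Sum>a\<in>A. u a) = (\<Sum>a\<in>A. c \<cdot> u a)"
  by (simp add: tensor_scale_def fun_eq_iff sum_fun_apply sum_distrib_left)

lemma zero_in_tensor_space [simp]: "0 \<in> tensor_space n r"
  by (simp add: tensor_space_def)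

lemma add_in_tensor_space [simp]:
  "u \<in> tensor_space n r \<Longrightarrow> v \<in> tensor_space n r \<Longrightarrow> u + v \<in> tensor_space n r"
  by (simp add: tensor_space_def)

lemma scale_in_tensor_space [simp]: "u \<in> tensor_space n r \<Longrightarrow> c \<cdot> u \<in> tensor_space n r"
  by (simp add: tensor_space_def tensor_scale_def)

lemma diff_in_tensor_space [simp]:
  "u \<in> tensor_space n r \<Longrightarrow> v \<in> tensor_space n r \<Longrightarrow> u - v \<in> tensor_space n r"
  by (simp add: tensor_space_def)

lemma sum_in_tensor_space [simp]:
  "(\<And>a. a \<in> A \<Longrightarrow> f a \<in> tensor_space n r) \<Longrightarrow> (\<Sum>a\<in>A. f a) \<in> tensor_space n r"
  by (induction A rule: infinite_finite_induct) auto

text \<open>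
  The diagrams span the algebra; this reduces a given action to the operators of the diagrams.
\<close>

lemma poly_mapping_sum_single:
  assumes "x \<in> partition_algebra r"
  shows "x = (\<Sum>d\<in>diagrams r. Poly_Mapping.single d (Poly_Mapping.lookup x d))"
proof (rule poly_mapping_eqI)
  fix f
  have "Poly_Mapping.lookup x f = (\<Sum>d\<in>diagrams r. if d = f then Poly_Mapping.lookup x d else 0)"
    using assms by (auto simp: finite_diagrams partition_algebra_def in_keys_iff)
  then show "Poly_Mapping.lookup x f
      = Poly_Mapping.lookup (\<Sum>d\<in>diagrams r. Poly_Mapping.single d (Poly_Mapping.lookup x d)) f"
    by (simp add: lookup_sum lookup_single when_def)
qed

lemma pa_mult_single:
  "pa_mult \<delta> (Poly_Mapping.single d 1) (Poly_Mapping.single e 1)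
    = pa_scale (\<delta> ^ loops d e) (Poly_Mapping.single (diagram_comp d e) 1)"
  by (simp add: pa_mult_def)

context tensor_action
begin

definition act_diagram :: "diagram \<Rightarrow> tensor \<Rightarrow> tensor" where
  "act_diagram d = act (Poly_Mapping.single d 1)"

lemma act_diagram_closed [simp]:
  "d \<in> diagrams r \<Longrightarrow> u \<in> tensor_space n r \<Longrightarrow> act_diagram d u \<in> tensor_space n r"
  by (simp add: act_diagram_def act_closed single_in_partition_algebra)

lemma act_diagram_add:
  "\<lbrakk>d \<in> diagrams r; u \<in> tensor_space n r; v \<in> tensor_space n r\<rbrakk> \<Longrightarrow>
    act_diagram d (u + v) = act_diagram d u + act_diagram d v"
  by (simp add: act_diagram_def act_add_right single_in_partition_algebra)

lemma act_diagram_scale: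
  "\<lbrakk>d \<in> diagrams r; u \<in> tensor_space n r\<rbrakk> \<Longrightarrow> act_diagram d (c \<cdot> u) = c \<cdot> act_diagram d u"
  by (simp add: act_diagram_def act_scale_right single_in_partition_algebra)

lemma act_diagram_zero: "d \<in> diagrams r \<Longrightarrow> act_diagram d 0 = 0"
  using act_diagram_scale[of d 0 0] by simp

lemma act_diagram_sum:
  assumes "d \<in> diagrams r" "\<And>a. a \<in> A \<Longrightarrow> u a \<in> tensor_space n r"
  shows "act_diagram d (\<Sum>a\<in>A. u a) = (\<Sum>a\<in>A. act_diagram d (u a))"
  using assms(2)
  by (induction A rule: infinite_finite_induct) (simp_all add: act_diagram_add act_diagram_zero assms(1))

lemma act_diagram_comp:
  assumes "d \<in> diagrams r" "e \<in> diagrams r" "u \<in> tensor_space n r"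
  shows "act_diagram d (act_diagram e u) = of_nat n ^ loops d e \<cdot> act_diagram (diagram_comp d e) u"
  using assms
  by (simp add: act_diagram_def single_in_partition_algebra diagram_comp_in_diagrams pa_mult_single
      flip: act_mult act_scale_left)

text \<open>
  The action on $V^{\otimes r}$ of an element of $\mathcal{A}_k(z)$, for $k \le r$, through the
  embedding into $\mathcal{A}_r(z)$ and the specialization to $A_r(n)$.
\<close>

definition strand_act :: "nat \<Rightarrow> (diagram \<Rightarrow>\<^sub>0 int poly) \<Rightarrow> tensor \<Rightarrow> tensor" where
  "strand_act k x u = (\<Sum>d\<in>diagrams k.
     eval_at n (Poly_Mapping.lookup x d) \<cdot> act_diagram (extend_diagram k r d) u)"

lemma strand_act_closed [simp]:
  "k \<le> r \<Longrightarrow> u \<in> tensor_space n r \<Longrightarrow> strand_act k x u \<in> tensor_space n r"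
  by (simp add: strand_act_def extend_diagram_in_diagrams)

lemma strand_act_add: "strand_act k (x + y) u = strand_act k x u + strand_act k y u"
  by (simp add: strand_act_def lookup_add eval_at_add tensor_scale_add_left sum.distrib)

lemma strand_act_uminus: "strand_act k (- x) u = - strand_act k x u"
  by (simp add: strand_act_def eval_at_uminus tensor_scale_uminus_left sum_negf)

lemma strand_act_diff: "strand_act k (x - y) u = strand_act k x u - strand_act k y u"
  using strand_act_add[of k x "- y" u] by (simp add: strand_act_uminus)

lemma strand_act_zero [simp]: "strand_act k 0 u = 0"
  by (simp add: strand_act_def)

text \<open>
  Vertical strands change neither the composite of two diagrams nor the number of deleted components,
  so the structure constants on \<open>k\<close> strands are those of the extended diagrams, and $z^\ell$
  specializes to the factor $n^\ell$ in the product on $A_r(n)$.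
\<close>

lemma strand_act_mult:
  assumes k: "k \<le> r" and x: "x \<in> partition_algebra k" and y: "y \<in> partition_algebra k"
    and u: "u \<in> tensor_space n r"
  shows "strand_act k (x \<star> y) u = strand_act k x (strand_act k y u)"
proof -
  let ?D = "diagrams k" and ?e = "extend_diagram k r"
  let ?x = "\<lambda>d. eval_at n (Poly_Mapping.lookup x d)" and ?y = "\<lambda>d. eval_at n (Poly_Mapping.lookup y d)"
  have D: "?e d \<in> diagrams r" if "d \<in> ?D" for d
    using that k by (rule extend_diagram_in_diagrams)
  have "strand_act k (x \<star> y) u = (\<Sum>f\<in>?D. \<Sum>d\<in>?D. \<Sum>e\<in>?D. if diagram_comp d e = f
      then (of_nat n ^ loops d e * ?x d * ?y e) \<cdot> act_diagram (?e f) u else 0)"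
    unfolding strand_act_def lookup_pa_mult[OF x y] eval_at_sum tensor_scale_sum_left
    by (intro sum.cong refl) (simp add: eval_at_mult eval_at_z_power)
  also have "\<dots> = (\<Sum>d\<in>?D. \<Sum>f\<in>?D. \<Sum>e\<in>?D. if diagram_comp d e = f
      then (of_nat n ^ loops d e * ?x d * ?y e) \<cdot> act_diagram (?e f) u else 0)"
    by (rule sum.swap)
  also have "\<dots> = (\<Sum>d\<in>?D. \<Sum>e\<in>?D. \<Sum>f\<in>?D. if diagram_comp d e = f
      then (of_nat n ^ loops d e * ?x d * ?y e) \<cdot> act_diagram (?e f) u else 0)"
    by (rule sum.cong[OF refl]) (rule sum.swap)
  also have "\<dots> = (\<Sum>d\<in>?D. \<Sum>e\<in>?D.
      (of_nat n ^ loops d e * ?x d * ?y e) \<cdot> act_diagram (?e (diagram_comp d e)) u)"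
    by (intro sum.cong refl) (simp add: finite_diagrams diagram_comp_in_diagrams)
  also have "\<dots> = (\<Sum>d\<in>?D. \<Sum>e\<in>?D. ?x d \<cdot> ?y e \<cdot> act_diagram (?e d) (act_diagram (?e e) u))"
    by (intro sum.cong refl)
       (simp add: act_diagram_comp D u diagram_comp_extend loops_extend tensor_scale_scale mult_ac)
  also have "\<dots> = strand_act k x (strand_act k y u)"
    unfolding strand_act_def by (intro sum.cong refl)
       (simp add: act_diagram_sum act_diagram_scale D u tensor_scale_sum_right)
  finally show ?thesis .
qed

text \<open>
  An element may thus be viewed on any number of strands; the recursions can be evaluated with the
  formulas found for fewer strands.
\<close>

lemma strand_act_embed:
  assumes "j \<le> k" "k \<le> r" and x: "x \<in> partition_algebra j"
  shows "strand_act k (pa_embed j k x) = strand_act j x"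
proof
  fix u
  let ?e = "extend_diagram j k" and ?x = "\<lambda>d. eval_at n (Poly_Mapping.lookup x d)"
  have "strand_act k (pa_embed j k x) u = (\<Sum>f\<in>diagrams k. \<Sum>d\<in>diagrams j.
      if ?e d = f then ?x d \<cdot> act_diagram (extend_diagram k r f) u else 0)"
    unfolding strand_act_def lookup_pa_embed[OF x] eval_at_sum tensor_scale_sum_left
    by (intro sum.cong refl) simp
  also have "\<dots> = (\<Sum>d\<in>diagrams j. \<Sum>f\<in>diagrams k.
      if ?e d = f then ?x d \<cdot> act_diagram (extend_diagram k r f) u else 0)"
    by (rule sum.swap)
  also have "\<dots> = strand_act j x u"
    unfolding strand_act_def
    by (intro sum.cong refl)
       (simp add: finite_diagrams extend_diagram_in_diagrams extend_diagram_trans assms(1,2))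
  finally show "strand_act k (pa_embed j k x) u = strand_act j x u" .
qed

lemma strand_act_single:
  assumes "d \<in> diagrams k"
  shows "strand_act k (Poly_Mapping.single d 1) u = act_diagram (extend_diagram k r d) u"
proof -
  have "strand_act k (Poly_Mapping.single d 1) u
      = (\<Sum>e\<in>diagrams k. if d = e then act_diagram (extend_diagram k r e) u else 0)"
    unfolding strand_act_def by (intro sum.cong refl) (simp add: lookup_single when_def)
  then show ?thesis using assms by (simp add: finite_diagrams)
qed

lemma strand_act_linear:
  assumes k: "k \<le> r"
  shows "strand_act k x 0 = 0"
    and "\<lbrakk>u \<in> tensor_space n r; v \<in> tensor_space n r\<rbrakk> \<Longrightarrow> strand_act k x (u + v) = strand_act k x u + strand_act k x v"
    and "u \<in> tensor_space n r \<Longrightarrow> strand_act k x (c \<cdot> u) = c \<cdot> strand_act k x u"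
  by (simp_all add: strand_act_def extend_diagram_in_diagrams[OF _ k] act_diagram_zero act_diagram_add act_diagram_scale
      tensor_scale_add_right sum.distrib tensor_scale_sum_right tensor_scale_scale mult.commute)

lemma strand_act_diff_right:
  assumes "k \<le> r" "u \<in> tensor_space n r" "v \<in> tensor_space n r"
  shows "strand_act k x (u - v) = strand_act k x u - strand_act k x v"
  using strand_act_linear(2)[OF assms(1), of "u - v" v x] assms by simp

lemma strand_act_sum:
  assumes "k \<le> r" "\<And>a. a \<in> A \<Longrightarrow> u a \<in> tensor_space n r"
  shows "strand_act k x (\<Sum>a\<in>A. u a) = (\<Sum>a\<in>A. strand_act k x (u a))"
  using assms(2)
  by (induction A rule: infinite_finite_induct) (simp_all add: strand_act_linear assms(1))

lemma strand_act_if: "k \<le> r \<Longrightarrow> strand_act k x (if P then u else 0) = (if P then strand_act k x u else 0)"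
  by (simp add: strand_act_linear)

lemma act_zero: assumes "u \<in> tensor_space n r" shows "act 0 u = 0"
  using act_add_left[of 0 0 u] assms by simp

lemma act_specialize:
  assumes x: "x \<in> partition_algebra r" and u: "u \<in> tensor_space n r"
  shows "act (specialize n x) u = strand_act r x u"
proof -
  let ?s = "\<lambda>d. Poly_Mapping.single d (Poly_Mapping.lookup (specialize n x) d)"
  have s: "?s d \<in> partition_algebra r" if "d \<in> diagrams r" for d
    using that by (rule single_in_partition_algebra)
  have sum: "act (\<Sum>d\<in>D. ?s d) u = (\<Sum>d\<in>D. act (?s d) u)" if "finite D" "D \<subseteq> diagrams r" for D
    using that
    by (induction rule: finite_induct) (simp_all add: act_zero u s act_add_left sum_in_partition_algebra subset_iff)
  have single: "act (?s d) u = eval_at n (Poly_Mapping.lookup x d) \<cdot> act_diagram d u" if "d \<in> diagrams r" for d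
    using act_scale_left[OF single_in_partition_algebra[OF that] u,
        of "eval_at n (Poly_Mapping.lookup x d)" 1]
    by (simp add: act_diagram_def lookup_specialize)
  have "specialize n x \<in> partition_algebra r"
    using x unfolding partition_algebra_def
    by (auto simp: subset_iff in_keys_iff lookup_specialize) (metis eval_at_0)
  then have "act (specialize n x) u = act (\<Sum>d\<in>diagrams r. ?s d) u"
    by (subst poly_mapping_sum_single) simp_all
  also have "\<dots> = strand_act r x u"
    by (simp add: sum finite_diagrams single strand_act_def)
  finally show ?thesis .
qed

text \<open>
  The basis vectors are indexed by lists of letters so that a position is singled out by splitting the
  list. Lists of the wrong length or with letters out of range stand for \<open>0\<close>, so the rules
  for \<open>gen_s\<close> and \<open>gen_p_half\<close> below hold for all lists.
\<close>

definition word :: "nat list \<Rightarrow> tensor" where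
  "word ws = (if length ws = r \<and> set ws \<subseteq> {1..n} then tensor r (\<lambda>t. unit_vec (ws ! (t - 1))) else 0)"

lemma tensor_cong: "(\<And>t. t \<in> {1..r} \<Longrightarrow> w t = w' t) \<Longrightarrow> tensor r w = tensor r w'"
  unfolding tensor_def by (intro ext if_cong prod.cong refl) auto

lemma word_in_range:
  assumes "length ws = r" "set ws \<subseteq> {1..n}"
  shows "(\<lambda>t. ws ! (t - 1)) \<in> {1..r} \<rightarrow> {1..n}"
proof
  fix t assume "t \<in> {1..r}"
  then have "ws ! (t - 1) \<in> set ws" using assms(1) by (intro nth_mem) auto
  then show "ws ! (t - 1) \<in> {1..n}" using assms(2) by blast
qed

lemma word_in_tensor_space [simp]: "word ws \<in> tensor_space n r"
proof (cases "length ws = r \<and> set ws \<subseteq> {1..n}")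
  case True
  then show ?thesis
    using tensor_unit_vec'[OF word_in_range[of ws]] by (auto simp: word_def tensor_space_def)
qed (auto simp: word_def)

lemma tensor_eq_word:
  assumes "i \<in> {1..r} \<rightarrow> {1..n}"
  shows "tensor r (\<lambda>t. unit_vec (i t)) = word (map i [1..<Suc r])"
proof -
  have "set (map i [1..<Suc r]) \<subseteq> {1..n}" using assms by auto
  then have "word (map i [1..<Suc r]) = tensor r (\<lambda>t. unit_vec (map i [1..<Suc r] ! (t - 1)))"
    by (simp add: word_def del: upt_Suc)
  also have "\<dots> = tensor r (\<lambda>t. unit_vec (i t))"
  proof (rule tensor_cong)
    fix t assume "t \<in> {1..r}"
    then have "map i [1..<Suc r] ! (t - 1) = i t"
      by (subst nth_map) (auto simp del: upt_Suc)
    then show "unit_vec (map i [1..<Suc r] ! (t - 1)) = unit_vec (i t)" by simp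
  qed
  finally show ?thesis ..
qed

lemma strand_act_gen_s:
  assumes w: "Suc (length w) = i" and k: "i < k" "k \<le> r"
  shows "strand_act k (gen_s k i) (word (w @ a # b # u)) = word (w @ b # a # u)"
proof -
  have i: "1 \<le> i" "i + 1 \<le> k" using w k by auto
  let ?v = "w @ a # b # u" and ?v' = "w @ b # a # u"
  have full: "strand_act k (gen_s k i) v = act (gen_s r i) v" for v
    using i k by (simp add: gen_s_def strand_act_single s_diagram extend_s_diagram act_diagram_def)
  show ?thesis
  proof (cases "length ?v = r \<and> set ?v \<subseteq> {1..n}")
    case True
    then have v: "word ?v = tensor r (\<lambda>t. unit_vec (?v ! (t - 1)))"
      "word ?v' = tensor r (\<lambda>t. unit_vec (?v' ! (t - 1)))"
      by (auto simp: word_def)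
    have "strand_act k (gen_s k i) (word ?v)
        = tensor r (\<lambda>t. unit_vec (?v ! (transpose i (i + 1) t - 1)))"
      unfolding full v using True i k by (intro act_s word_in_range) auto
    also have "\<dots> = word ?v'"
      unfolding v(2)
    proof (rule tensor_cong)
      fix t assume "t \<in> {1..r}"
      then show "unit_vec (?v ! (transpose i (i + 1) t - 1)) = unit_vec (?v' ! (t - 1))"
        unfolding transpose_def w[symmetric] by (auto simp: nth_append nth_Cons')
    qed
    finally show ?thesis .
  next
    case False
    then have "word ?v = 0" "word ?v' = 0" unfolding word_def by (simp_all only: if_False) auto
    then show ?thesis using k(2) by (simp add: strand_act_linear)
  qed
qed

lemma strand_act_gen_p_half:
  assumes w: "Suc (length w) = i" and k: "i < k" "k \<le> r"
  shows "strand_act k (gen_p_half k i) (word (w @ a # b # u)) = (if a = b then word (w @ a # b # u) else 0)"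
proof -
  have i: "1 \<le> i" "i + 1 \<le> k" using w k by auto
  let ?v = "w @ a # b # u"
  have full: "strand_act k (gen_p_half k i) v = act (gen_p_half r i) v" for v
    using i k by (simp add: gen_p_half_def strand_act_single p_half_diagram extend_p_half_diagram act_diagram_def)
  show ?thesis
  proof (cases "length ?v = r \<and> set ?v \<subseteq> {1..n}")
    case True
    then have v: "word ?v = tensor r (\<lambda>t. unit_vec (?v ! (t - 1)))"
      by (auto simp: word_def)
    have "?v ! (i - 1) = a" "?v ! (i + 1 - 1) = b"
      unfolding w[symmetric] by (simp_all add: nth_append)
    then show ?thesis
      unfolding full v using act_p_half[of i "\<lambda>t. ?v ! (t - 1)"] word_in_range[of ?v] True i k by simp
  next
    case False
    then have "word ?v = 0" unfolding word_def by (simp only: if_False)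
    then show ?thesis using strand_act_linear(1)[OF k(2)] by auto
  qed
qed

text \<open>
  Here the letter \<open>a\<close> must be in range: otherwise the left-hand side is \<open>0\<close>, whereas on the
  right \<open>a\<close> is replaced by letters that are in range.
\<close>

lemma strand_act_gen_p:
  assumes w: "Suc (length w) = i" and k: "i \<le> k" "k \<le> r" and a: "a \<in> {1..n}"
  shows "strand_act k (gen_p k i) (word (w @ a # u)) = (\<Sum>j=1..n. word (w @ j # u))"
proof -
  have i: "1 \<le> i" "i \<le> k" using w k by auto
  let ?v = "w @ a # u" and ?v' = "\<lambda>j. w @ j # u"
  have full: "strand_act k (gen_p k i) v = act (gen_p r i) v" for v
    using i k by (simp add: gen_p_def strand_act_single p_diagram extend_p_diagram act_diagram_def)
  show ?thesis
  proof (cases "length ?v = r \<and> set ?v \<subseteq> {1..n}")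
    case True
    then have v: "word ?v = tensor r (\<lambda>t. unit_vec (?v ! (t - 1)))"
      by (auto simp: word_def)
    have "strand_act k (gen_p k i) (word ?v)
        = (\<Sum>j=1..n. tensor r (\<lambda>t. if t = i then unit_vec j else unit_vec (?v ! (t - 1))))"
      unfolding full v using True i k by (intro act_p word_in_range) auto
    also have "\<dots> = (\<Sum>j=1..n. word (?v' j))"
    proof (rule sum.cong[OF refl])
      fix j assume "j \<in> {1..n}"
      then have "word (?v' j) = tensor r (\<lambda>t. unit_vec (?v' j ! (t - 1)))"
        using True by (auto simp: word_def)
      also have "\<dots> = tensor r (\<lambda>t. if t = i then unit_vec j else unit_vec (?v ! (t - 1)))"
        unfolding w[symmetric] by (rule tensor_cong) (auto simp: nth_append nth_Cons')
      finally show "tensor r (\<lambda>t. if t = i then unit_vec j else unit_vec (?v ! (t - 1)))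
        = word (?v' j)" ..
    qed
    finally show ?thesis .
  next
    case False
    then have "word ?v = 0" "word (?v' j) = 0" for j
      using a unfolding word_def by (simp_all only: if_False) auto
    then show ?thesis using k(2) by (simp add: strand_act_linear)
  qed
qed


section \<open>The four recursive families\<close>

text \<open>
  The operators expected of $L_k$, $L_{k-\frac12}$, $\sigma_{k+1}$ and $\sigma_{k+\frac12}$, where
  \<open>l\<close> is $k - 1$, the number of letters to the left of position $k$. The tail \<open>u\<close> absorbs
  the tensor factors on which these elements do not act.
\<close>

definition acts_as_L :: "nat \<Rightarrow> (tensor \<Rightarrow> tensor) \<Rightarrow> bool" where
  "acts_as_L l T \<longleftrightarrow> (\<forall>w a u. length w = l \<longrightarrow> set (w @ a # u) \<subseteq> {1..n} \<longrightarrow>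
     T (word (w @ a # u)) = (\<Sum>j=1..n. word (map (transpose a j) w @ j # u)))"

definition acts_as_L_half :: "nat \<Rightarrow> (tensor \<Rightarrow> tensor) \<Rightarrow> bool" where
  "acts_as_L_half l T \<longleftrightarrow> (\<forall>w a u. length w = l \<longrightarrow> set (w @ a # u) \<subseteq> {1..n} \<longrightarrow>
     T (word (w @ a # u)) =
       of_nat n \<cdot> word (w @ a # u) - (\<Sum>j=1..n. word (map (transpose a j) w @ a # u)))"

definition acts_as_sigma :: "nat \<Rightarrow> (tensor \<Rightarrow> tensor) \<Rightarrow> bool" where
  "acts_as_sigma l T \<longleftrightarrow> (\<forall>w a b u. length w = l \<longrightarrow> set (w @ a # b # u) \<subseteq> {1..n} \<longrightarrow>
     T (word (w @ a # b # u)) = word (map (transpose a b) w @ b # a # u))"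

definition acts_as_sigma_half :: "nat \<Rightarrow> (tensor \<Rightarrow> tensor) \<Rightarrow> bool" where
  "acts_as_sigma_half l T \<longleftrightarrow> (\<forall>w a b u. length w = l \<longrightarrow> set (w @ a # b # u) \<subseteq> {1..n} \<longrightarrow>
     T (word (w @ a # b # u)) = word (map (transpose a b) w @ a # b # u))"

text \<open>
  The same rules with one more letter displayed on the left: rewriting does not find the splitting
  \<open>(w @ [c]) @ a # u\<close> of \<open>w @ c # a # u\<close>.
\<close>

lemma strand_act_gen_s':
  "\<lbrakk>Suc (Suc (length w)) = i; i < k; k \<le> r\<rbrakk> \<Longrightarrow>
    strand_act k (gen_s k i) (word (w @ c # a # b # u)) = word (w @ c # b # a # u)"
  using strand_act_gen_s[of "w @ [c]" i k a b u] by simp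

lemma strand_act_gen_p_half':
  "\<lbrakk>Suc (Suc (length w)) = i; i < k; k \<le> r\<rbrakk> \<Longrightarrow>
    strand_act k (gen_p_half k i) (word (w @ c # a # b # u)) = (if a = b then word (w @ c # a # b # u) else 0)"
  using strand_act_gen_p_half[of "w @ [c]" i k a b u] by simp

lemma strand_act_gen_p':
  "\<lbrakk>Suc (Suc (length w)) = i; i \<le> k; k \<le> r; a \<in> {1..n}\<rbrakk> \<Longrightarrow>
    strand_act k (gen_p k i) (word (w @ c # a # u)) = (\<Sum>j=1..n. word (w @ c # j # u))"
  using strand_act_gen_p[of "w @ [c]" i k a u] by simp

lemmas strand_act_algebra =
  strand_act_add strand_act_diff strand_act_uminus strand_act_mult
  strand_act_sum strand_act_if strand_act_linear

lemmas strand_act_generators =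
  strand_act_gen_s strand_act_gen_s' strand_act_gen_p strand_act_gen_p'
  strand_act_gen_p_half strand_act_gen_p_half'

lemma sum_eq_single_difference:
  fixes f g :: "'a \<Rightarrow> 'b::ab_group_add"
  assumes "finite A" "a \<in> A" "\<And>j. j \<in> A - {a} \<Longrightarrow> f j = g j"
  shows "sum g A = sum f A + (g a - f a)"
proof -
  have "sum g (A - {a}) = sum f (A - {a})" using assms(3) by (intro sum.cong) auto
  then show ?thesis using assms(1,2) by (simp add: sum.remove)
qed

text \<open>
  On \<open>w @ [a, b, c]\<close> the conjugate of the previous $\sigma$ moves \<open>w\<close> and exchanges \<open>b\<close> and \<open>c\<close>
  but leaves \<open>a\<close> alone, whereas the result should contain $s_{b,c}(a)$. If \<open>a\<close> is \<open>b\<close>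
  or \<open>c\<close>, one of the two positive terms gives the correct word and the matching negative term cancels
  the wrong one. If all three letters agree, both corrections occur, and each vanishes.
\<close>

lemma acts_as_sigma_step:
  assumes r: "Suc (Suc (Suc l)) \<le> r"
    and S: "S \<in> partition_algebra (Suc (Suc (Suc l)))" "acts_as_sigma l (strand_act (Suc (Suc (Suc l))) S)"
    and W: "W \<in> partition_algebra (Suc (Suc (Suc l)))" "acts_as_L l (strand_act (Suc (Suc (Suc l))) W)"
  shows "acts_as_sigma (Suc l) (strand_act (Suc (Suc (Suc l))) (sigma_step (Suc (Suc l)) S W))"
  unfolding acts_as_sigma_def
proof (intro allI impI)
  let ?K = "Suc (Suc (Suc l))"
  fix w' b c u assume "length w' = Suc l" and rng': "set (w' @ b # c # u) \<subseteq> {1..n}"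
  then obtain w a where w': "w' = w @ [a]" and w: "length w = l" by (metis length_Suc_conv_rev)
  have rng: "set w \<subseteq> {1..n}" "a \<in> {1..n}" "b \<in> {1..n}" "c \<in> {1..n}" "set u \<subseteq> {1..n}"
    using rng' by (auto simp: w')
  have Sw: "strand_act ?K S (word (w @ x # y # v)) = word (map (transpose x y) w @ y # x # v)"
    if "x \<in> {1..n}" "y \<in> {1..n}" "set v \<subseteq> {1..n}" for x y v
    using S(2) w rng(1) that unfolding acts_as_sigma_def by simp
  have Ww: "strand_act ?K W (word (w @ x # v)) = (\<Sum>j=1..n. word (map (transpose x j) w @ j # v))"
    if "x \<in> {1..n}" "set v \<subseteq> {1..n}" for x v
    using W(2) w rng(1) that unfolding acts_as_L_def by simp
  have "strand_act ?K (sigma_step (Suc (Suc l)) S W) (word (w @ a # b # c # u))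
      = word (map (transpose b c) w @ a # c # b # u)
      + (if a = c then word (map (transpose a b) w @ b # c # b # u) else 0)
      + (if a = b then word (map (transpose a c) w @ c # c # a # u) else 0)
      - (if a = b then word (map (transpose a c) w @ a # c # b # u) else 0)
      - (if a = c then word (map (transpose a b) w @ a # c # b # u) else 0)"
    using r S(1) W(1) w rng
    by (simp add: sigma_step_def Let_def strand_act_algebra strand_act_generators Sw Ww transpose_commute)
  then show "strand_act ?K (sigma_step (Suc (Suc l)) S W) (word (w' @ b # c # u))
      = word (map (transpose b c) w' @ c # b # u)"
    by (cases "a = b"; cases "a = c") (simp_all add: w' transpose_commute)
qed

text \<open>
  The five terms are those of \<open>sigma_step\<close> up to a final exchange of the last two letters, and they
  correct the conjugate in the same way.
\<close>

lemma acts_as_sigma_half_step: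
  assumes r: "Suc (Suc (Suc l)) \<le> r"
    and S: "S \<in> partition_algebra (Suc (Suc (Suc l)))" "acts_as_sigma_half l (strand_act (Suc (Suc (Suc l))) S)"
    and W: "W \<in> partition_algebra (Suc (Suc (Suc l)))" "acts_as_L l (strand_act (Suc (Suc (Suc l))) W)"
  shows "acts_as_sigma_half (Suc l) (strand_act (Suc (Suc (Suc l))) (sigma_half_step (Suc (Suc l)) S W))"
  unfolding acts_as_sigma_half_def
proof (intro allI impI)
  let ?K = "Suc (Suc (Suc l))"
  fix w' b c u assume "length w' = Suc l" and rng': "set (w' @ b # c # u) \<subseteq> {1..n}"
  then obtain w a where w': "w' = w @ [a]" and w: "length w = l" by (metis length_Suc_conv_rev)
  have rng: "set w \<subseteq> {1..n}" "a \<in> {1..n}" "b \<in> {1..n}" "c \<in> {1..n}" "set u \<subseteq> {1..n}"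
    using rng' by (auto simp: w')
  have Sw: "strand_act ?K S (word (w @ x # y # v)) = word (map (transpose x y) w @ x # y # v)"
    if "x \<in> {1..n}" "y \<in> {1..n}" "set v \<subseteq> {1..n}" for x y v
    using S(2) w rng(1) that unfolding acts_as_sigma_half_def by simp
  have Ww: "strand_act ?K W (word (w @ x # v)) = (\<Sum>j=1..n. word (map (transpose x j) w @ j # v))"
    if "x \<in> {1..n}" "set v \<subseteq> {1..n}" for x v
    using W(2) w rng(1) that unfolding acts_as_L_def by simp
  have "strand_act ?K (sigma_half_step (Suc (Suc l)) S W) (word (w @ a # b # c # u))
      = word (map (transpose b c) w @ a # b # c # u)
      + (if a = c then word (map (transpose a b) w @ b # b # c # u) else 0)
      + (if a = b then word (map (transpose a c) w @ c # b # c # u) else 0)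
      - (if a = b then word (map (transpose a c) w @ a # b # c # u) else 0)
      - (if a = c then word (map (transpose a b) w @ a # b # c # u) else 0)"
    using r S(1) W(1) w rng
    by (simp add: sigma_half_step_def Let_def strand_act_algebra strand_act_generators Sw Ww transpose_commute)
  then show "strand_act ?K (sigma_half_step (Suc (Suc l)) S W) (word (w' @ b # c # u))
      = word (map (transpose b c) w' @ b # c # u)"
    by (cases "a = b"; cases "a = c") (simp_all add: w' transpose_commute)
qed

text \<open>
  For \<open>w @ [a, b]\<close> the conjugate of $L_k$ produces the sum of words in which \<open>a\<close> is kept instead
  of being moved by $s_{b,j}$. For \<open>a \<noteq> b\<close> this is wrong only in the summand with \<open>j = a\<close>: the term
  $p_{i+\frac12}L_is_i$ removes that summand and $\sigma_{i+1}$ supplies the right one. For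
  \<open>a = b\<close> all summands may be wrong; two further terms exchange the whole sum for the correct one,
  and then $p_{i+\frac12}L_is_i$ and $\sigma_{i+1}$ cancel.
\<close>

lemma acts_as_L_step:
  assumes r: "Suc (Suc l) \<le> r"
    and X: "X \<in> partition_algebra (Suc (Suc l))" "acts_as_L l (strand_act (Suc (Suc l)) X)"
    and S: "acts_as_sigma l (strand_act (Suc (Suc l)) S)"
  shows "acts_as_L (Suc l) (strand_act (Suc (Suc l)) (L_step (Suc l) X S))"
  unfolding acts_as_L_def
proof (intro allI impI)
  let ?K = "Suc (Suc l)"
  fix w' b u assume "length w' = Suc l" and rng': "set (w' @ b # u) \<subseteq> {1..n}"
  then obtain w a where w': "w' = w @ [a]" and w: "length w = l" by (metis length_Suc_conv_rev)
  have rng: "set w \<subseteq> {1..n}" "a \<in> {1..n}" "b \<in> {1..n}" "set u \<subseteq> {1..n}"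
    using rng' by (auto simp: w')
  have Sw: "strand_act ?K S (word (w @ a # b # u)) = word (map (transpose a b) w @ b # a # u)"
    using S w rng unfolding acts_as_sigma_def by simp
  have Xw: "strand_act ?K X (word (w @ x # v)) = (\<Sum>j=1..n. word (map (transpose x j) w @ j # v))"
    if "x \<in> {1..n}" "set v \<subseteq> {1..n}" for x v
    using X(2) w rng(1) that unfolding acts_as_L_def by simp
  \<comment> \<open>The summands \<open>f j\<close> come from the conjugate, the summands \<open>g j\<close> are wanted.\<close>
  define f where "f j = word (map (transpose b j) w @ a # j # u)" for j
  define g where "g j = word (map (transpose b j) w @ transpose b j a # j # u)" for j
  have step: "strand_act ?K (L_step (Suc l) X S) (word (w @ a # b # u))
      = - (if a = b then \<Sum>j=1..n. f j else 0) - f' + (if a = b then \<Sum>j=1..n. g j else 0)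
        + (\<Sum>j=1..n. f j) + word (map (transpose a b) w @ b # a # u)"
    if "f' = word (map (transpose a b) w @ a # a # u)" for f'
    unfolding that f_def g_def using r X(1) w rng
    by (simp add: L_step_def Let_def strand_act_algebra strand_act_generators Sw Xw transpose_commute cong: sum.cong_simp)
  have "strand_act ?K (L_step (Suc l) X S) (word (w @ a # b # u)) = (\<Sum>j=1..n. g j)"
  proof (cases "a = b")
    case True
    then show ?thesis using step[OF refl] by simp
  next
    case False
    have "f j = g j" if "j \<in> {1..n} - {a}" for j
      using that False by (cases "j = b") (simp_all add: f_def g_def)
    then have "(\<Sum>j=1..n. g j) = (\<Sum>j=1..n. f j) + (g a - f a)"
      using rng(2) by (intro sum_eq_single_difference) simp_all
    moreover have "f a = word (map (transpose a b) w @ a # a # u)"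
      "g a = word (map (transpose a b) w @ b # a # u)"
      by (simp_all add: f_def g_def transpose_commute)
    then have "strand_act ?K (L_step (Suc l) X S) (word (w @ a # b # u)) = (\<Sum>j=1..n. f j) + (g a - f a)"
      using step[of "f a"] False by simp
    ultimately show ?thesis by simp
  qed
  then show "strand_act ?K (L_step (Suc l) X S) (word (w' @ b # u))
      = (\<Sum>j=1..n. word (map (transpose b j) w' @ j # u))"
    by (simp add: w' g_def)
qed

text \<open>
  The comparison is the one for $L_{k+1}$, with the sums subtracted and the last letter kept, so the
  correcting terms enter with the roles of the right and the wrong summands interchanged.
\<close>

lemma acts_as_L_half_step:
  assumes r: "Suc (Suc l) \<le> r"
    and X: "X \<in> partition_algebra (Suc (Suc l))" "acts_as_L l (strand_act (Suc (Suc l)) X)"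
    and Y: "Y \<in> partition_algebra (Suc (Suc l))" "acts_as_L_half l (strand_act (Suc (Suc l)) Y)"
    and S: "acts_as_sigma_half l (strand_act (Suc (Suc l)) S)"
  shows "acts_as_L_half (Suc l) (strand_act (Suc (Suc l)) (L_half_step (Suc l) X Y S))"
  unfolding acts_as_L_half_def
proof (intro allI impI)
  let ?K = "Suc (Suc l)"
  fix w' b u assume "length w' = Suc l" and rng': "set (w' @ b # u) \<subseteq> {1..n}"
  then obtain w a where w': "w' = w @ [a]" and w: "length w = l" by (metis length_Suc_conv_rev)
  have rng: "set w \<subseteq> {1..n}" "a \<in> {1..n}" "b \<in> {1..n}" "set u \<subseteq> {1..n}"
    using rng' by (auto simp: w')
  have Sw: "strand_act ?K S (word (w @ a # b # u)) = word (map (transpose a b) w @ a # b # u)"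
    using S w rng unfolding acts_as_sigma_half_def by simp
  have Xw: "strand_act ?K X (word (w @ x # v)) = (\<Sum>j=1..n. word (map (transpose x j) w @ j # v))"
    if "x \<in> {1..n}" "set v \<subseteq> {1..n}" for x v
    using X(2) w rng(1) that unfolding acts_as_L_def by simp
  have Yw: "strand_act ?K Y (word (w @ b # a # u))
      = of_nat n \<cdot> word (w @ b # a # u) - (\<Sum>j=1..n. word (map (transpose b j) w @ b # a # u))"
    using Y(2) w rng unfolding acts_as_L_half_def by simp
  \<comment> \<open>The summands \<open>f j\<close> come from the conjugate, the summands \<open>g j\<close> are wanted.\<close>
  define f where "f j = word (map (transpose b j) w @ a # b # u)" for j
  define g where "g j = word (map (transpose b j) w @ transpose b j a # b # u)" for j
  have step: "strand_act ?K (L_half_step (Suc l) X Y S) (word (w @ a # b # u))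
      = - (if a = b then \<Sum>j=1..n. g j else 0) - g' + (if a = b then \<Sum>j=1..n. f j else 0)
        + (of_nat n \<cdot> word (w @ a # b # u) - (\<Sum>j=1..n. f j)) + f a"
    if "g' = word (map (transpose a b) w @ b # b # u)" for g'
    unfolding that f_def g_def using r X(1) Y(1) w rng
    by (simp add: L_half_step_def Let_def strand_act_algebra strand_act_diff_right strand_act_generators Sw Xw Yw
        transpose_commute cong: sum.cong_simp)
  have "strand_act ?K (L_half_step (Suc l) X Y S) (word (w @ a # b # u))
      = of_nat n \<cdot> word (w @ a # b # u) - (\<Sum>j=1..n. g j)"
  proof (cases "a = b")
    case True
    then show ?thesis using step[OF refl] by (simp add: f_def)
  next
    case False
    have "f j = g j" if "j \<in> {1..n} - {a}" for j
      using that False by (cases "j = b") (simp_all add: f_def g_def)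
    then have "(\<Sum>j=1..n. g j) = (\<Sum>j=1..n. f j) + (g a - f a)"
      using rng(2) by (intro sum_eq_single_difference) simp_all
    moreover have "g a = word (map (transpose a b) w @ b # b # u)"
      by (simp add: g_def transpose_commute)
    then have "strand_act ?K (L_half_step (Suc l) X Y S) (word (w @ a # b # u))
        = of_nat n \<cdot> word (w @ a # b # u) - ((\<Sum>j=1..n. f j) + (g a - f a))"
      using step[of "g a"] False by simp
    ultimately show ?thesis by simp
  qed
  then show "strand_act ?K (L_half_step (Suc l) X Y S) (word (w' @ b # u))
      = of_nat n \<cdot> word (w' @ b # u) - (\<Sum>j=1..n. word (map (transpose b j) w' @ b # u))"
    by (simp add: w' g_def)
qed

lemma strand_act_pa_one: "k \<le> r \<Longrightarrow> u \<in> tensor_space n r \<Longrightarrow> strand_act k (pa_one k) u = u"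
  using act_one by (simp add: pa_one_def strand_act_single id_diagram extend_id_diagram act_diagram_def)

text \<open>
  The two families are interleaved so that each induction step uses only its predecessor:
  $L_{l+1}$ and $\sigma_{l+2}$ determine both $L_{l+2}$ and $\sigma_{l+3}$.
\<close>

lemma L_int_sigma_int_action:
  "(Suc l \<le> r \<longrightarrow> acts_as_L l (strand_act (Suc l) (L_int (Suc l)))) \<and>
   (Suc (Suc l) \<le> r \<longrightarrow> acts_as_sigma l (strand_act (Suc (Suc l)) (sigma_int (Suc (Suc l)))))"
proof (induction l)
  case 0
  show ?case
  proof (intro conjI impI)
    assume "Suc 0 \<le> r"
    then show "acts_as_L 0 (strand_act (Suc 0) (L_int (Suc 0)))"
      using strand_act_gen_p[of "[]" 1 1] by (simp add: acts_as_L_def)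
  next
    assume "Suc (Suc 0) \<le> r"
    then show "acts_as_sigma 0 (strand_act (Suc (Suc 0)) (sigma_int (Suc (Suc 0))))"
      using strand_act_gen_s[of "[]" 1 2] by (simp add: acts_as_sigma_def numeral_2_eq_2)
  qed
next
  case (Suc l)
  note mem = L_int_sigma_int_in_partition_algebra
  show ?case
  proof (intro conjI impI)
    assume r: "Suc (Suc l) \<le> r"
    then show "acts_as_L (Suc l) (strand_act (Suc (Suc l)) (L_int (Suc (Suc l))))"
      using acts_as_L_step[OF r _ _ conjunct2[OF Suc, rule_format, OF r]] Suc mem
      by (simp add: strand_act_embed)
  next
    assume r: "Suc (Suc (Suc l)) \<le> r"
    then show "acts_as_sigma (Suc l) (strand_act (Suc (Suc (Suc l))) (sigma_int (Suc (Suc (Suc l)))))"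
      using acts_as_sigma_step[OF r] Suc mem by (simp add: strand_act_embed)
  qed
qed

lemma sigma_half_action:
  "Suc (Suc l) \<le> r \<Longrightarrow> acts_as_sigma_half l (strand_act (Suc (Suc l)) (sigma_half (Suc (Suc l))))"
proof (induction l)
  case 0
  then show ?case using strand_act_pa_one[of 2] by (simp add: acts_as_sigma_half_def numeral_2_eq_2)
next
  case (Suc l)
  then show ?case
    using acts_as_sigma_half_step[OF Suc.prems] L_int_sigma_int_action[of l]
    by (simp add: strand_act_embed L_int_sigma_int_in_partition_algebra sigma_half_in_partition_algebra)
qed

lemma L_half_action:
  "Suc l \<le> r \<Longrightarrow> acts_as_L_half l (strand_act (Suc l) (L_half (Suc l)))"
proof (induction l)
  case 0
  \<comment> \<open>$L_{1/2} = 0$: with no letters on the left, the \<open>n\<close> summands all equal the given word.\<close>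
  show ?case by (auto simp: acts_as_L_half_def tensor_scale_def fun_eq_iff sum_fun_apply)
next
  case (Suc l)
  then show ?case
    using acts_as_L_half_step[OF Suc.prems _ _ _ _ sigma_half_action]
      L_int_sigma_int_action[of l]
    by (simp add: strand_act_embed L_int_sigma_int_in_partition_algebra L_half_in_partition_algebra)
qed

lemma twisted_tensor_eq_word:
  assumes i: "i \<in> {1..r} \<rightarrow> {1..n}" and c: "c \<in> {1..n}" and j: "j \<in> {1..n}" and r: "r = Suc l"
  shows "tensor r (\<lambda>t. if t = r then unit_vec c else perm_vec (transpose (i r) j) (unit_vec (i t)))
    = word (map (transpose (i r) j) (map i [1..<r]) @ [c])"
proof -
  let ?f = "\<lambda>t. if t = r then c else transpose (i r) j (i t)"
  have "transpose (i r) j (i t) \<in> {1..n}" if "t \<in> {1..r}" for t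
  proof -
    have "i r \<in> {1..n}" "i t \<in> {1..n}" using i that r by auto
    then show ?thesis using j by (simp add: transpose_def)
  qed
  then have "?f \<in> {1..r} \<rightarrow> {1..n}" using c by auto
  then have "tensor r (\<lambda>t. unit_vec (?f t)) = word (map ?f [1..<Suc r])"
    by (rule tensor_eq_word)
  also have "map ?f [1..<Suc r] = map (transpose (i r) j) (map i [1..<r]) @ [c]"
    using r by simp
  moreover have "unit_vec (?f t)
      = (if t = r then unit_vec c else perm_vec (transpose (i r) j) (unit_vec (i t)))" for t
    by (simp add: perm_vec_unit_vec)
  ultimately show ?thesis by (simp only:)
qed

end

theorem proposition5p3:
  fixes n k :: nat and i :: "nat \<Rightarrow> nat"
    and act :: "(diagram \<Rightarrow>\<^sub>0 complex) \<Rightarrow> tensor \<Rightarrow> tensor"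
  assumes "n \<ge> 1" and "k \<ge> 1" and "\<forall>t\<in>{1..k}. 1 \<le> i t \<and> i t \<le> n"
    and "tensor_action n k act"
  shows "act (specialize n (L_half k)) (tensor k (\<lambda>t. unit_vec (i t)))
           = of_nat n \<cdot> tensor k (\<lambda>t. unit_vec (i t))
             - (\<Sum>j=1..n. tensor k (\<lambda>t. if t = k then unit_vec (i k)
                                      else perm_vec (transpose (i k) j) (unit_vec (i t))))
         \<and> act (specialize n (L_int k)) (tensor k (\<lambda>t. unit_vec (i t)))
           = (\<Sum>j=1..n. tensor k (\<lambda>t. if t = k then unit_vec j
                                    else perm_vec (transpose (i k) j) (unit_vec (i t))))"
proof -
  interpret tensor_action n k act by fact
  obtain l where k: "k = Suc l" using assms(2) by (cases k) auto
  have i: "i \<in> {1..k} \<rightarrow> {1..n}" using assms(3) by auto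
  define w where "w = map i [1..<k]"
  have w: "length w = l" "set (w @ i k # []) \<subseteq> {1..n}"
    using i k by (auto simp: w_def)
  have ik: "i k \<in> {1..n}" using w(2) by simp
  have e: "tensor k (\<lambda>t. unit_vec (i t)) = word (w @ i k # [])"
    using tensor_eq_word[OF i] k by (simp add: w_def)
  have tw: "tensor k (\<lambda>t. if t = k then unit_vec c else perm_vec (transpose (i k) j) (unit_vec (i t)))
      = word (map (transpose (i k) j) w @ c # [])" if "c \<in> {1..n}" "j \<in> {1..n}" for c j
    unfolding w_def by (rule twisted_tensor_eq_word[OF i that k])
  have "act (specialize n (L_half k)) (word (w @ i k # [])) = strand_act k (L_half k) (word (w @ i k # []))"
    "act (specialize n (L_int k)) (word (w @ i k # [])) = strand_act k (L_int k) (word (w @ i k # []))"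
    using assms(2)
    by (simp_all add: act_specialize L_half_in_partition_algebra L_int_sigma_int_in_partition_algebra)
  moreover have "acts_as_L_half l (strand_act k (L_half k))" "acts_as_L l (strand_act k (L_int k))"
    using L_half_action[of l] L_int_sigma_int_action[of l] k by auto
  ultimately show ?thesis
    using w unfolding e acts_as_L_half_def acts_as_L_def by (simp add: tw ik cong: sum.cong_simp)
qed

end
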